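(* Consider a Bin Packing instance with item weights $w(1),\ldots,w(n)$ and bin capacities $c_1,\ldots,c_m$. For any $B \subseteq [m]$ and any given family $\mathcal{W} \subseteq 2^{[n]}$, one can compute, for all $X \in {\downarrow}\mathcal{W}$, whether $X$ can be divided over the bins in $B$, in time $\mathcal{O}(|{\downarrow}\mathcal{W}| n)$. Similarly, for any $B \subseteq [m]$ and given $\mathcal{W} \subseteq 2^{[n]}$, one can compute, for all $X \in {\uparrow}\mathcal{W}$, whether $[n] \setminus X$ can be divided over the bins in $B$, in time $\mathcal{O}(|{\uparrow}\mathcal{W}| n)$.
   Context: Bin Packing instance: item weights $w(1),\ldots,w(n) \in \mathbb{N}$, capacities $c_1,\ldots,c_m \in \mathbb{N}$, with $m$ a constant; $w(X) := \sum_{i \in X} w(i)$. A set $X \subseteq [n]$ can be divided over bins $B \subseteq [m]$ if there is a partition $(X_j)_{j \in B}$ of $X$ (parts may be empty) with $w(X_j) \le c_j$ for all $j \in B$. Down-closure ${\downarrow}\mathcal{W} := \{X : X \subseteq W \text{ for some } W \in \mathcal{W}\}$, up-closure ${\uparrow}\mathcal{W} := \{X \subseteq [n]: X \supseteq W \text{ for some } W \in \mathcal{W}\}$. Arithmetic operations take constant time. *)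

theory Defs
  imports "HOL-Library.Disjoint_Sets"
begin

section \<open>Bin packing\<close>

definition can_divide ::
    "(nat \<Rightarrow> nat) \<Rightarrow> (nat \<Rightarrow> nat) \<Rightarrow> nat set \<Rightarrow> nat set \<Rightarrow> bool" where
  "can_divide w c X B \<longleftrightarrow>
     (\<exists>P. disjoint_family_on P B \<and> (\<Union>j\<in>B. P j) = X \<and> (\<forall>j\<in>B. sum w (P j) \<le> c j))"

definition down_closure :: "nat set set \<Rightarrow> nat set set" where
  "down_closure \<W> = {X. \<exists>S\<in>\<W>. X \<subseteq> S}"

definition up_closure :: "nat \<Rightarrow> nat set set \<Rightarrow> nat set set" where
  "up_closure n \<W> = {X. X \<subseteq> {1..n} \<and> (\<exists>S\<in>\<W>. S \<subseteq> X)}"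

section \<open>The machine model\<close>

text \<open>
  Running time is measured on a unit-cost random access machine, programmed in a structured
  language. The memory consists of named arrays of natural numbers that are indexed by natural
  numbers; a scalar variable is cell \<open>0\<close> of an array. A program mentions only finitely many
  array names, so the arrays can be interleaved in a single memory with constant overhead.

  Every operation (constant, memory access, addition, subtraction, comparison, Boolean
  connective, branching) takes one time unit, regardless of the size of the numbers. Unit-cost
  multiplication and division are deliberately absent: on unbounded numbers they would make the
  machine unreasonably powerful, whereas upper bounds that hold without them hold with them too.
\<close>

type_synonym store = "string \<Rightarrow> nat \<Rightarrow> nat"

datatype aexp =
    Const nat
  | Read string aexp
  | Add aexp aexp
  | Sub aexp aexp  \<comment> \<open>truncated at \<open>0\<close>\<close>

datatype bexp = Leq aexp aexp | Neg bexp | Conj bexp bexp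

datatype com =
    Skip
  | Write string aexp aexp  \<comment> \<open>\<open>Write a i e\<close> is the assignment \<open>a[i] := e\<close>\<close>
  | Seq com com
  | Cond bexp com com
  | While bexp com

fun aval :: "aexp \<Rightarrow> store \<Rightarrow> nat" where
  "aval (Const k) s = k"
| "aval (Read a i) s = s a (aval i s)"
| "aval (Add e1 e2) s = aval e1 s + aval e2 s"
| "aval (Sub e1 e2) s = aval e1 s - aval e2 s"

fun acost :: "aexp \<Rightarrow> nat" where
  "acost (Const k) = 1"
| "acost (Read a i) = 1 + acost i"
| "acost (Add e1 e2) = 1 + acost e1 + acost e2"
| "acost (Sub e1 e2) = 1 + acost e1 + acost e2"

fun bval :: "bexp \<Rightarrow> store \<Rightarrow> bool" where
  "bval (Leq e1 e2) s \<longleftrightarrow> aval e1 s \<le> aval e2 s"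
| "bval (Neg b) s \<longleftrightarrow> \<not> bval b s"
| "bval (Conj b1 b2) s \<longleftrightarrow> bval b1 s \<and> bval b2 s"

fun bcost :: "bexp \<Rightarrow> nat" where
  "bcost (Leq e1 e2) = 1 + acost e1 + acost e2"
| "bcost (Neg b) = 1 + bcost b"
| "bcost (Conj b1 b2) = 1 + bcost b1 + bcost b2"

text \<open>
  \<open>exec p s t s'\<close>: started in memory \<open>s\<close>, the program \<open>p\<close> halts after exactly \<open>t\<close> time units
  with memory \<open>s'\<close>.
\<close>

inductive exec :: "com \<Rightarrow> store \<Rightarrow> nat \<Rightarrow> store \<Rightarrow> bool" where
  Skip: "exec Skip s 1 s"
| Write: "exec (Write a i e) s (1 + acost i + acost e) (s(a := (s a)(aval i s := aval e s)))"
| Seq: "exec p s t s' \<Longrightarrow> exec q s' u s'' \<Longrightarrow> exec (Seq p q) s (t + u) s''"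
| CondTrue: "bval b s \<Longrightarrow> exec p s t s' \<Longrightarrow> exec (Cond b p q) s (1 + bcost b + t) s'"
| CondFalse: "\<not> bval b s \<Longrightarrow> exec q s t s' \<Longrightarrow> exec (Cond b p q) s (1 + bcost b + t) s'"
| WhileFalse: "\<not> bval b s \<Longrightarrow> exec (While b p) s (1 + bcost b) s"
| WhileTrue: "bval b s \<Longrightarrow> exec p s t s' \<Longrightarrow> exec (While b p) s' u s'' \<Longrightarrow>
    exec (While b p) s (1 + bcost b + t + u) s''"

lemma exec_deterministic:
  "exec p s t s' \<Longrightarrow> exec p s u s'' \<Longrightarrow> u = t \<and> s'' = s'"
proof (induction arbitrary: u s'' rule: exec.induct)
  case (Skip s)
  then show ?case by (cases rule: exec.cases) auto
next
  case (Write a i e s)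
  then show ?case by (cases rule: exec.cases) auto
next
  case (Seq p s t s' q v s3)
  from Seq.prems show ?case by (cases rule: exec.cases) (use Seq.IH in blast)
next
  case (CondTrue b s p t s' q)
  from CondTrue.prems show ?case
    by (cases rule: exec.cases) (use CondTrue.IH CondTrue.hyps in blast)+
next
  case (CondFalse b s q t s' p)
  from CondFalse.prems show ?case
    by (cases rule: exec.cases) (use CondFalse.IH CondFalse.hyps in blast)+
next
  case (WhileFalse b s p)
  from WhileFalse.prems show ?case
    by (cases rule: exec.cases) (use WhileFalse.hyps in blast)+
next
  case (WhileTrue b s p t s' v s3)
  from WhileTrue.prems show ?case
    by (cases rule: exec.cases) (use WhileTrue.IH WhileTrue.hyps in blast)+
qed

section \<open>Input and output\<close>

text \<open>Sets are passed as characteristic vectors, with one memory cell per potential element.\<close>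

definition char_vec :: "nat \<Rightarrow> nat set \<Rightarrow> nat list" where
  "char_vec n X = map (\<lambda>i. if i \<in> X then 1 else 0) [1..<Suc n]"

definition array :: "nat list \<Rightarrow> nat \<Rightarrow> nat" where
  "array xs i = (if i < length xs then xs ! i else 0)"

text \<open>
  The list \<open>Ws\<close> enumerates the given family, one row of \<open>n\<close> cells after the other. Array cells
  are counted from \<open>0\<close>, so item \<open>i\<close> is stored in cell \<open>i - 1\<close>. All other memory is zero.
\<close>

definition input_store ::
    "nat \<Rightarrow> nat \<Rightarrow> (nat \<Rightarrow> nat) \<Rightarrow> (nat \<Rightarrow> nat) \<Rightarrow> nat set \<Rightarrow> nat set list \<Rightarrow> store" where
  "input_store m n w c B Ws = (\<lambda>_ _. 0)
     (''m'' := array [m],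
      ''n'' := array [n],
      ''w'' := array (map w [1..<Suc n]),
      ''c'' := array (map c [1..<Suc m]),
      ''B'' := array (char_vec m B),
      ''family_size'' := array [length Ws],
      ''family'' := array (concat (map (char_vec n) Ws)))"

definition holds :: "store \<Rightarrow> string \<Rightarrow> nat list \<Rightarrow> bool" where
  "holds s a xs \<longleftrightarrow> (\<forall>i<length xs. s a i = xs ! i)"

text \<open>
  The output lists each member of the family \<open>\<F>\<close> exactly once, in any order, together with one
  answer bit per member, which says whether the member has the property \<open>Q\<close>.
\<close>

definition outputs :: "store \<Rightarrow> nat \<Rightarrow> nat set set \<Rightarrow> (nat set \<Rightarrow> bool) \<Rightarrow> bool" where
  "outputs s n \<F> Q \<longleftrightarrow>
     (\<exists>Xs. distinct Xs \<and> set Xs = \<F> \<and>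
        holds s ''out_size'' [length Xs] \<and>
        holds s ''out_sets'' (concat (map (char_vec n) Xs)) \<and>
        holds s ''out_answers'' (map (\<lambda>X. if Q X then 1 else 0) Xs))"

end

theory Submission
  imports Defs "HOL-Library.Nat_Bijection"
begin

text \<open>
  Lay out the bins one after the other on a line and let \<open>T(X)\<close> be the least position below which
  the items of \<open>X\<close> can be packed. The last item \<open>i\<close> of an optimal packing may be taken from the last
  nonempty bin, so \<open>T(X)\<close> is the minimum, over \<open>i \<in> X\<close> and over the bins, of the end of \<open>i\<close> when it is
  placed as early as possible after \<open>T(X - {i})\<close>. Since the number of bins is constant, this costs
  \<open>O(n)\<close> per set, once the values of the subsets are known.

  A depth-first search from each given set, which removes one item at a time and returns to the
  larger set by means of a stack, visits every member of the down-closure after its subsets. A set is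
  identified by the number with the corresponding binary digits, which is updated by one addition or
  subtraction and serves as the address of the entries of the set, so that sets already visited are
  recognised in constant time. The up-closure is reduced to the down-closure by complementing the
  bits when they are read and when they are written.
\<close>

section \<open>Reasoning about programs\<close>

text \<open>One number per set suffices because positions are totally ordered and placing an item is
  monotone: if the other items can end earlier, every placement of \<open>i\<close> remains
  possible. No vector of remaining capacities is needed, and the number of bins enters the time only
  linearly. Addresses of sets range up to almost 2^(n+1), so the tables cannot be cleared within the
  time bound and the memory must be used as it is, zero. Hence the encoding of values in which 0
  means that no position is known, and invariants saying that entries of unvisited sets are still
  initial. The obstacle to verification is that a recursion over sets is executed by a flat loop on
  shared memory. While subsets of a set are visited, its own value is only partially computed, so a
  visit must be shown to preserve all values outside the power set of the visited set. Time is
  charged to sets: each is finished once and pays for its own output and for its descents and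
  returns, also those to subsets finished earlier, whose cost is independent of \<open>n\<close>.
  Distinctness of the given sets bounds the reading of the input by the size of the closure.\<close>

definition runs :: "com \<Rightarrow> store \<Rightarrow> (nat \<Rightarrow> store \<Rightarrow> bool) \<Rightarrow> bool" where
  "runs p s Q \<longleftrightarrow> (\<exists>t s'. exec p s t s' \<and> Q t s')"

inductive_cases exec_SeqE: "exec (Seq p q) s t s'"
inductive_cases exec_CondE: "exec (Cond b p q) s t s'"

text \<open>The rules for straight-line code are equivalences, so that rewriting computes the final
  memory and the elapsed time together.\<close>

lemma runs_Skip [simp]: "runs Skip s Q \<longleftrightarrow> Q 1 s"
  unfolding runs_def using exec.Skip exec_deterministic by metis

lemma runs_Write [simp]:
  "runs (Write a i e) s Q \<longleftrightarrow>
     Q (1 + acost i + acost e) (s(a := (s a)(aval i s := aval e s)))"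
  unfolding runs_def using exec.Write exec_deterministic by metis

lemma runs_Seq [simp]:
  "runs (Seq p q) s Q \<longleftrightarrow> runs p s (\<lambda>t s'. runs q s' (\<lambda>u s''. Q (t + u) s''))"
proof
  assume "runs (Seq p q) s Q"
  then obtain t s' where "exec (Seq p q) s t s'" "Q t s'" unfolding runs_def by blast
  then show "runs p s (\<lambda>t s'. runs q s' (\<lambda>u s''. Q (t + u) s''))"
    by (elim exec_SeqE) (auto simp: runs_def)
next
  assume "runs p s (\<lambda>t s'. runs q s' (\<lambda>u s''. Q (t + u) s''))"
  then obtain t s' u s'' where "exec p s t s'" "exec q s' u s''" "Q (t + u) s''"
    unfolding runs_def by blast
  then show "runs (Seq p q) s Q" unfolding runs_def using exec.Seq by blast
qed

lemma runs_Cond [simp]: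
  "runs (Cond b p q) s Q \<longleftrightarrow>
     (if bval b s then runs p s (\<lambda>t. Q (1 + bcost b + t)) else runs q s (\<lambda>t. Q (1 + bcost b + t)))"
proof -
  have "exec (Cond b p q) s u s' \<longleftrightarrow>
      (\<exists>t. u = 1 + bcost b + t \<and> (if bval b s then exec p s t s' else exec q s t s'))" for u s'
    using exec.CondTrue[of b s p _ s' q] exec.CondFalse[of b s q _ s' p]
    by (cases "bval b s") (auto elim: exec_CondE)
  then show ?thesis unfolding runs_def by auto
qed

lemma runs_conseq:
  "runs p s Q \<Longrightarrow> (\<And>t s'. Q t s' \<Longrightarrow> R t s') \<Longrightarrow> runs p s R"
  unfolding runs_def by blast

text \<open>\<open>\<Phi>\<close> bounds the remaining time and is also the termination measure,
  since each round costs at least one unit. The surplus \<open>1 + bcost b\<close> pays for the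
  last, failing test of the guard.\<close>

lemma runs_While:
  assumes "I s"
    and "\<And>s. I s \<Longrightarrow> bval b s \<Longrightarrow> runs p s (\<lambda>t s'. I s' \<and> 1 + bcost b + t + \<Phi> s' \<le> \<Phi> s)"
  shows "runs (While b p) s (\<lambda>t s'. I s' \<and> \<not> bval b s' \<and> t + \<Phi> s' \<le> \<Phi> s + 1 + bcost b)"
  using assms(1)
proof (induction "\<Phi> s" arbitrary: s rule: less_induct)
  case less
  show ?case
  proof (cases "bval b s")
    case True
    obtain t s' where 1: "exec p s t s'" "I s'" "1 + bcost b + t + \<Phi> s' \<le> \<Phi> s"
      using assms(2)[OF less.prems True] unfolding runs_def by blast
    then obtain u s'' where 2: "exec (While b p) s' u s''" "I s''" "\<not> bval b s''"
      "u + \<Phi> s'' \<le> \<Phi> s' + 1 + bcost b"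
      using less.hyps[of s'] unfolding runs_def by auto
    have "exec (While b p) s (1 + bcost b + t + u) s''"
      using True 1(1) 2(1) by (rule exec.WhileTrue)
    moreover have "1 + bcost b + t + u + \<Phi> s'' \<le> \<Phi> s + 1 + bcost b"
      using 1(3) 2(4) by linarith
    ultimately show ?thesis unfolding runs_def using 2 by blast
  next
    case False
    then have "exec (While b p) s (1 + bcost b) s" by (rule exec.WhileFalse)
    with False less.prems show ?thesis unfolding runs_def by (intro exI conjI) auto
  qed
qed

fun writes :: "com \<Rightarrow> string set" where
  "writes Skip = {}"
| "writes (Write a i e) = {a}"
| "writes (Seq p q) = writes p \<union> writes q"
| "writes (Cond b p q) = writes p \<union> writes q"
| "writes (While b p) = writes p"

lemma exec_writes: "exec p s t s' \<Longrightarrow> a \<notin> writes p \<Longrightarrow> s' a = s a"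
  by (induction rule: exec.induct) auto

lemma runs_frame:
  "runs p s Q \<Longrightarrow> runs p s (\<lambda>t s'. Q t s' \<and> (\<forall>a. a \<notin> writes p \<longrightarrow> s' a = s a))"
  unfolding runs_def using exec_writes by blast

text \<open>
  Partial runs of a loop make it possible to verify the search, which is a flat loop, by recursion
  on the current set.
\<close>

inductive reach :: "bexp \<Rightarrow> com \<Rightarrow> store \<Rightarrow> nat \<Rightarrow> store \<Rightarrow> bool" for b p where
  reach_refl: "reach b p s 0 s"
| reach_step: "bval b s \<Longrightarrow> exec p s t s' \<Longrightarrow> reach b p s' u s'' \<Longrightarrow>
    reach b p s (1 + bcost b + t + u) s''"

lemma reach_trans: "reach b p s t s' \<Longrightarrow> reach b p s' u s'' \<Longrightarrow> reach b p s (t + u) s''"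
proof (induction rule: reach.induct)
  case (reach_step s t s' u' s'')
  show ?case
    using reach.reach_step[OF reach_step.hyps(1,2) reach_step.IH[OF reach_step.prems]]
    by (simp add: add.assoc)
qed simp

lemma reach_exec:
  "reach b p s t s' \<Longrightarrow> exec (While b p) s' u s'' \<Longrightarrow> exec (While b p) s (t + u) s''"
proof (induction rule: reach.induct)
  case (reach_step s t s' u' s3)
  show ?case
    using exec.WhileTrue[OF reach_step.hyps(1,2) reach_step.IH[OF reach_step.prems]]
    by (simp add: add.assoc)
qed simp

lemma runs_reach:
  assumes "bval b s" "runs p s Q"
  obtains t s' where "reach b p s (1 + bcost b + t) s'" "Q t s'"
proof -
  obtain t s' where "exec p s t s'" "Q t s'" using assms(2) unfolding runs_def by blast
  then show thesis using that reach_step[OF assms(1) _ reach_refl] by (metis add.right_neutral)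
qed

section \<open>Packing along a line\<close>

text \<open>
  The bins are laid out consecutively on a line, bin \<open>j\<close> starting at \<open>start j\<close>. A division of
  \<open>X\<close> fits below \<open>q\<close> if no nonempty bin is filled beyond the position \<open>q\<close>.
\<close>

locale bin_packing =
  fixes m :: nat and w c :: "nat \<Rightarrow> nat" and B :: "nat set"
  assumes bins: "B \<subseteq> {1..m}"
begin

definition start :: "nat \<Rightarrow> nat" where
  "start j = sum c {1..<j}"

definition fits :: "nat set \<Rightarrow> nat \<Rightarrow> bool" where
  "fits X q \<longleftrightarrow> (\<exists>P. disjoint_family_on P B \<and> (\<Union>j\<in>B. P j) = X \<and>
     (\<forall>j\<in>B. P j \<noteq> {} \<longrightarrow> start j + sum w (P j) \<le> min q (start j + c j)))"

lemma start_Suc: "1 \<le> j \<Longrightarrow> start (Suc j) = start j + c j"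
  unfolding start_def by simp

lemma start_add_le:
  assumes "1 \<le> i" "i < j" shows "start i + c i \<le> start j"
proof -
  have "start (Suc i) \<le> start j"
    using assms unfolding start_def by (intro sum_mono2) auto
  then show ?thesis using start_Suc[OF assms(1)] by simp
qed

lemma finite_bins: "finite B"
  using bins by (rule finite_subset) simp

lemma fits_empty: "fits {} q"
  unfolding fits_def by (rule exI[of _ "\<lambda>_. {}"]) (auto simp: disjoint_family_on_def)

lemma can_divide_iff_fits: "can_divide w c X B \<longleftrightarrow> (\<exists>q. fits X q)"
proof
  assume "can_divide w c X B"
  then obtain P where P: "disjoint_family_on P B" "(\<Union>j\<in>B. P j) = X" "\<forall>j\<in>B. sum w (P j) \<le> c j"
    unfolding can_divide_def by blast
  \<comment> \<open>Any common upper bound on the ends of the bins is a witness for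
    \<open>q\<close>; the sum of the ends is one.\<close>
  have "start j + c j \<le> (\<Sum>j\<in>B. start j + c j)" if "j \<in> B" for j
    using member_le_sum[OF that, of "\<lambda>j. start j + c j"] finite_bins by simp
  then have "fits X (\<Sum>j\<in>B. start j + c j)"
    unfolding fits_def using P by (intro exI[of _ P]) fastforce
  then show "\<exists>q. fits X q" ..
next
  assume "\<exists>q. fits X q"
  then obtain q P where P: "disjoint_family_on P B" "(\<Union>j\<in>B. P j) = X"
    "\<forall>j\<in>B. P j \<noteq> {} \<longrightarrow> start j + sum w (P j) \<le> min q (start j + c j)"
    unfolding fits_def by blast
  have "sum w (P j) \<le> c j" if "j \<in> B" for j
    using P(3) that by (cases "P j = {}") auto
  then show "can_divide w c X B"
    unfolding can_divide_def using P by blast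
qed

text \<open>The parameter \<open>J\<close> restricts the bins tried for \<open>i\<close>, so that a
  scan over the bins is described by letting \<open>J\<close> grow.\<close>

definition extends :: "nat set \<Rightarrow> nat \<Rightarrow> nat set \<Rightarrow> nat \<Rightarrow> bool" where
  "extends X i J q \<longleftrightarrow>
     (\<exists>j\<in>J. \<exists>p. fits (X - {i}) p \<and> max p (start j) + w i \<le> min q (start j + c j))"

text \<open>The last item is taken from the last nonempty bin, so that all the other bins end before it.\<close>

lemma fits_remove:
  assumes "finite X" "X \<noteq> {}" "fits X q"
  obtains i where "i \<in> X" "extends X i B q"
proof -
  obtain P where P: "disjoint_family_on P B" "(\<Union>j\<in>B. P j) = X"
    "\<And>j. j \<in> B \<Longrightarrow> P j \<noteq> {} \<Longrightarrow> start j + sum w (P j) \<le> min q (start j + c j)"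
    using assms(3) unfolding fits_def by blast
  define N where "N = {j \<in> B. P j \<noteq> {}}"
  define j where "j = Max N"
  have N: "finite N" "N \<noteq> {}" using finite_bins assms(2) P(2) unfolding N_def by auto
  have j: "j \<in> B" "P j \<noteq> {}" using Max_in[OF N] unfolding j_def N_def by auto
  then obtain i where i: "i \<in> P j" by blast
  have fin: "finite (P j)" using P(2) j(1) by (intro finite_subset[OF _ assms(1)]) auto
  have split: "sum w (P j) = w i + sum w (P j - {i})" using fin i by (rule sum.remove)
  \<comment> \<open>\<open>p\<close> is where bin \<open>j\<close> ends without \<open>i\<close>. It
    is at least \<open>start j\<close>, and all earlier bins end at \<open>start j\<close> or
    before.\<close>
  define p where "p = start j + sum w (P j - {i})"
  have notin: "i \<notin> P l" if "l \<in> B" "l \<noteq> j" for l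
    using P(1) i j(1) that unfolding disjoint_family_on_def by blast
  have "fits (X - {i}) p"
    unfolding fits_def
  proof (intro exI conjI ballI impI)
    show "disjoint_family_on (P(j := P j - {i})) B"
      using P(1) unfolding disjoint_family_on_def by auto
    show "(\<Union>l\<in>B. (P(j := P j - {i})) l) = X - {i}"
      using P(2) notin j(1) by (auto split: if_splits)
    fix l assume l: "l \<in> B" "(P(j := P j - {i})) l \<noteq> {}"
    show "start l + sum w ((P(j := P j - {i})) l) \<le> min p (start l + c l)"
    proof (cases "l = j")
      case True
      then show ?thesis using P(3)[OF j] split by (simp add: p_def)
    next
      case False
      then have "l \<in> N" using l unfolding N_def by simp
      then have "l < j" using Max_ge[OF N(1)] False unfolding j_def by fastforce
      then have "start l + c l \<le> start j" using start_add_le bins l(1) by auto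
      moreover have "start l + sum w (P l) \<le> start l + c l" using P(3)[of l] l False by simp
      ultimately show ?thesis using False by (simp add: p_def)
    qed
  qed
  moreover have "max p (start j) + w i \<le> min q (start j + c j)"
    using P(3)[OF j] split by (simp add: p_def)
  ultimately have "extends X i B q" unfolding extends_def using j(1) by (intro bexI exI conjI)
  moreover have "i \<in> X" using i j(1) P(2) by auto
  ultimately show thesis using that by simp
qed

text \<open>Bin \<open>j\<close> need not be the last nonempty one here: whatever it already holds
  ends by \<open>max p (start j)\<close>, so \<open>i\<close> fits behind it, and every other
  nonempty bin ends by \<open>p \<le> q\<close>.\<close>

lemma fits_extends:
  assumes "finite X" "i \<in> X" "extends X i B q"
  shows "fits X q"
proof -
  obtain j p where j: "j \<in> B" "max p (start j) + w i \<le> min q (start j + c j)"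
    and p: "fits (X - {i}) p"
    using assms(3) unfolding extends_def by (elim bexE exE conjE)
  obtain P where P: "disjoint_family_on P B" "(\<Union>j\<in>B. P j) = X - {i}"
    "\<forall>j\<in>B. P j \<noteq> {} \<longrightarrow> start j + sum w (P j) \<le> min p (start j + c j)"
    using p unfolding fits_def by (elim exE conjE)
  have notin: "i \<notin> P l" if "l \<in> B" for l using P(2) that by auto
  have fin: "finite (P j)" using P(2) j(1) by (intro finite_subset[OF _ assms(1)]) auto
  show ?thesis
    unfolding fits_def
  proof (intro exI conjI ballI impI)
    show "disjoint_family_on (P(j := insert i (P j))) B"
      using P(1) notin unfolding disjoint_family_on_def by auto
    show "(\<Union>l\<in>B. (P(j := insert i (P j))) l) = X"
      using P(2) assms(2) j(1) by (auto split: if_splits)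
    fix l assume l: "l \<in> B" "(P(j := insert i (P j))) l \<noteq> {}"
    show "start l + sum w ((P(j := insert i (P j))) l) \<le> min q (start l + c l)"
    proof (cases "l = j")
      case True
      have "start j + sum w (P j) \<le> max p (start j)"
        using bspec[OF P(3) j(1)] by (cases "P j = {}") auto
      then show ?thesis using True j(2) notin[OF j(1)] fin by simp
    next
      case False
      have "p \<le> q" using j(2) max.cobounded1[of p "start j"] by linarith
      then show ?thesis using bspec[OF P(3) l(1)] l(2) False by simp
    qed
  qed
qed

text \<open>
  The least position below which \<open>X\<close> fits is stored incremented by one, with \<open>0\<close> meaning that
  there is none; \<open>above v\<close> is the set of positions that the stored value \<open>v\<close> admits.
\<close>

definition above :: "nat \<Rightarrow> nat set" where
  "above v = {q. 0 < v \<and> v \<le> Suc q}"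

text \<open>The condition on \<open>p\<close> is easier for smaller \<open>p\<close>, so only the
  least admissible position \<open>u - 1\<close> has to be tested.\<close>

lemma extends_iff:
  assumes "Collect (fits (X - {i})) = above u"
  shows "extends X i J q \<longleftrightarrow>
    (\<exists>j\<in>J. 0 < u \<and> max (u - 1) (start j) + w i \<le> min q (start j + c j))"
proof -
  have *: "fits (X - {i}) p \<longleftrightarrow> 0 < u \<and> u \<le> Suc p" for p
    using assms unfolding above_def by blast
  have eq: "(\<exists>p. fits (X - {i}) p \<and> max p (start j) + w i \<le> r) \<longleftrightarrow>
        0 < u \<and> max (u - 1) (start j) + w i \<le> r" for j r
  proof
    assume "\<exists>p. fits (X - {i}) p \<and> max p (start j) + w i \<le> r"
    then obtain p where "0 < u" "u \<le> Suc p" "max p (start j) + w i \<le> r" using * by blast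
    then show "0 < u \<and> max (u - 1) (start j) + w i \<le> r" by auto
  next
    assume "0 < u \<and> max (u - 1) (start j) + w i \<le> r"
    then show "\<exists>p. fits (X - {i}) p \<and> max p (start j) + w i \<le> r"
      using * by (intro exI[of _ "u - 1"]) auto
  qed
  show ?thesis unfolding extends_def eq by (rule refl)
qed

text \<open>What the scan over the items has established before item \<open>i\<close>; after the
  last item it coincides with \<open>fits X\<close>. The disjunct for the empty set is the base
  case, where there is no item to remove.\<close>

definition best :: "nat set \<Rightarrow> nat \<Rightarrow> nat \<Rightarrow> bool" where
  "best X i q \<longleftrightarrow> X = {} \<or> (\<exists>k\<in>X. k < i \<and> extends X k B q)"

lemma best_all:
  assumes "X \<subseteq> {1..n}"
  shows "best X (Suc n) = fits X"
proof (cases "X = {}")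
  case False
  have fin: "finite X" using assms by (rule finite_subset) simp
  have "best X (Suc n) q \<longleftrightarrow> (\<exists>k\<in>X. extends X k B q)" for q
    using False assms unfolding best_def by (auto simp: subset_iff less_Suc_eq_le)
  moreover have "(\<exists>k\<in>X. extends X k B q) \<longleftrightarrow> fits X q" for q
    using fits_extends[OF fin] by (auto elim: fits_remove[OF fin False])
  ultimately show ?thesis by (simp add: fun_eq_iff)
qed (simp add: best_def fits_empty fun_eq_iff)

lemma best_Suc:
  "i \<in> X \<Longrightarrow> best X (Suc i) q \<longleftrightarrow> best X i q \<or> extends X i B q"
  "i \<notin> X \<Longrightarrow> best X (Suc i) = best X i"
  unfolding best_def less_Suc_eq by blast+

lemma best_first: "X \<subseteq> {1..n} \<Longrightarrow> Collect (best X 1) = above (of_bool (X = {}))"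
  unfolding best_def above_def by (cases "X = {}") (auto dest: subsetD)

end

section \<open>The program\<close>

abbreviation var :: "string \<Rightarrow> aexp" where
  "var x \<equiv> Read x (Const 0)"

abbreviation assign :: "string \<Rightarrow> aexp \<Rightarrow> com" (infix "::=" 62) where
  "x ::= e \<equiv> Write x (Const 0) e"

abbreviation seq :: "com \<Rightarrow> com \<Rightarrow> com" (infixr ";;" 60) where
  "p ;; q \<equiv> Seq p q"

abbreviation positive :: "aexp \<Rightarrow> bexp" where
  "positive e \<equiv> Leq (Const 1) e"

abbreviation incr :: "string \<Rightarrow> com" where
  "incr x \<equiv> x ::= Add (var x) (Const 1)"

text \<open>With truncated subtraction, \<open>(child - 1) - start + start\<close> is the maximum of
  \<open>child - 1\<close> and \<open>start\<close>, so \<open>pos\<close> is the end of the item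
  when placed as early as possible. \<open>bin\<close> counts from 0 like the array cells.
  \<open>start\<close> also advances over bins outside \<open>B\<close>, which keep their place on
  the line.\<close>

definition relax_body :: com where
  "relax_body =
     ''pos'' ::= Add (Add (Sub (Sub (var ''child'') (Const 1)) (var ''start'')) (var ''start''))
                     (Read ''w'' (Sub (var ''item'') (Const 1))) ;;
     Cond (Conj (Conj (positive (var ''child'')) (positive (Read ''B'' (var ''bin''))))
            (Conj (Leq (var ''pos'') (Add (var ''start'') (Read ''c'' (var ''bin''))))
              (Neg (Conj (positive (Read ''val'' (var ''code'')))
                         (Leq (Read ''val'' (var ''code'')) (var ''pos''))))))
       (Write ''val'' (var ''code'') (Add (var ''pos'') (Const 1)))
       Skip ;;
     ''start'' ::= Add (var ''start'') (Read ''c'' (var ''bin'')) ;;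
     incr ''bin''"

definition relax :: com where
  "relax =
     ''start'' ::= Const 0 ;;
     ''bin'' ::= Const 0 ;;
     While (Leq (Add (var ''bin'') (Const 1)) (var ''m'')) relax_body"

context bin_packing
begin

definition env :: "nat \<Rightarrow> store \<Rightarrow> bool" where
  "env n s \<longleftrightarrow> s ''n'' 0 = n \<and> s ''m'' 0 = m \<and>
     (\<forall>i\<in>{1..n}. s ''w'' (i - 1) = w i) \<and>
     (\<forall>j<m. s ''c'' j = c (Suc j) \<and> s ''B'' j = of_bool (Suc j \<in> B)) \<and>
     (\<forall>i\<in>{1..n}. s ''pow'' i = 2 ^ i)"

text \<open>For positive \<open>v\<close>, \<open>above v\<close> is the ray from
  \<open>v - 1\<close>, and \<open>above 0\<close> is empty. A union of two rays is the longer one,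
  so the conditional overwriting in \<open>relax_body\<close> computes a minimum with 0 as neutral
  element.\<close>

lemma above_update:
  "\<not> (1 \<le> v \<and> v \<le> y) \<Longrightarrow> above (y + 1) = above v \<union> {q. y \<le> q}"
  "1 \<le> v \<Longrightarrow> v \<le> y \<Longrightarrow> above v = above v \<union> {q. y \<le> q}"
  unfolding above_def by auto

lemma runs_relax:
  assumes "env n s" and i: "s ''item'' 0 = i" "i \<in> {1..n}" "i \<in> X"
    and child: "Collect (fits (X - {i})) = above (s ''child'' 0)"
    and code: "s ''code'' 0 = k"
    and best: "Collect (best X i) = above (s ''val'' k)"
  shows "runs relax s (\<lambda>t s'. t \<le> 110 * (m + 1) \<and>
    Collect (best X (Suc i)) = above (s' ''val'' k) \<and>
    (\<forall>l. l \<noteq> k \<longrightarrow> s' ''val'' l = s ''val'' l) \<and>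
    (\<forall>a. a \<notin> {''start'', ''bin'', ''pos'', ''val''} \<longrightarrow> s' a = s a))"
proof -
  define I where "I s' \<longleftrightarrow> s' ''bin'' 0 \<le> m \<and> s' ''start'' 0 = start (Suc (s' ''bin'' 0)) \<and>
    above (s' ''val'' k) = {q. best X i q \<or> extends X i (B \<inter> {1..s' ''bin'' 0}) q} \<and>
    (\<forall>l. l \<noteq> k \<longrightarrow> s' ''val'' l = s ''val'' l) \<and>
    (\<forall>a. a \<notin> {''start'', ''bin'', ''pos'', ''val''} \<longrightarrow> s' a = s a)" for s' :: store
  define \<Phi> where "\<Phi> s' = 100 * (m - s' ''bin'' 0)" for s' :: store
  have step: "runs relax_body s' (\<lambda>t s''. I s'' \<and>
      1 + bcost (Leq (Add (var ''bin'') (Const 1)) (var ''m'')) + t + \<Phi> s'' \<le> \<Phi> s')"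
    if I: "I s'" and b: "bval (Leq (Add (var ''bin'') (Const 1)) (var ''m'')) s'" for s'
  proof -
    define j where "j = s' ''bin'' 0"
    define u where "u = s ''child'' 0"
    define y where "y = max (u - 1) (start (Suc j)) + w i"
    have frame: "\<forall>a. a \<notin> {''start'', ''bin'', ''pos'', ''val''} \<longrightarrow> s' a = s a"
      using I unfolding I_def by blast
    have same: "s' ''m'' = s ''m''" "s' ''child'' = s ''child''" "s' ''item'' = s ''item''"
      "s' ''code'' = s ''code''" "s' ''w'' = s ''w''" "s' ''c'' = s ''c''" "s' ''B'' = s ''B''"
      using frame by simp_all
    have j: "j < m" using b \<open>env n s\<close> same(1) unfolding env_def j_def by simp
    have vals: "s ''w'' (i - 1) = w i" "s ''c'' j = c (Suc j)" "s ''B'' j = of_bool (Suc j \<in> B)"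
      using \<open>env n s\<close> i j unfolding env_def by auto
    have start: "s' ''start'' 0 = start (Suc j)" using I unfolding I_def j_def by simp
    have start': "start (Suc (j + 1)) = start (Suc j) + c (Suc j)" using start_Suc[of "Suc j"] by simp
    \<comment> \<open>The next bin contributes either nothing or the whole ray from
      \<open>y\<close>; which of the two does not depend on \<open>q\<close>.\<close>
    have new: "extends X i (B \<inter> {1..Suc j}) q \<longleftrightarrow> extends X i (B \<inter> {1..j}) q \<or>
        (Suc j \<in> B \<and> 1 \<le> u \<and> y \<le> start (Suc j) + c (Suc j)) \<and> y \<le> q" for q
      unfolding extends_iff[OF child] u_def[symmetric] y_def
      by (auto simp: atLeastAtMostSuc_conv)
    have old: "above (s' ''val'' k) = {q. best X i q \<or> extends X i (B \<inter> {1..j}) q}"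
      using I unfolding I_def j_def by simp
    have upd:
      "\<not> (1 \<le> s' ''val'' k \<and> s' ''val'' k \<le> y) \<longrightarrow>
        above (y + 1) = {q. best X i q \<or> extends X i (B \<inter> {1..j + 1}) q}"
      "1 \<le> s' ''val'' k \<and> s' ''val'' k \<le> y \<longrightarrow>
        above (s' ''val'' k) = {q. best X i q \<or> extends X i (B \<inter> {1..j + 1}) q}"
      if "Suc j \<in> B \<and> 1 \<le> u \<and> y \<le> start (Suc j) + c (Suc j)"
      using that new above_update[of "s' ''val'' k" y] unfolding old by auto
    have noupd: "above (s' ''val'' k) = {q. best X i q \<or> extends X i (B \<inter> {1..j + 1}) q}"
      if "\<not> (Suc j \<in> B \<and> 1 \<le> u \<and> y \<le> start (Suc j) + c (Suc j))"
      unfolding old using that new by auto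
    have y: "u - 1 - start (Suc j) + start (Suc j) + w i = y" unfolding y_def by linarith
    have time: "100 * (m - j) = 100 * (m - (j + 1)) + 100" using j by simp
    note S = same code i(1) vals start start' y time j_def[symmetric] u_def[symmetric]
    show ?thesis
    proof (cases "Suc j \<in> B \<and> 1 \<le> u \<and> y \<le> start (Suc j) + c (Suc j)")
      case True
      show ?thesis
        using True I j upd[OF True] frame
        unfolding relax_body_def I_def \<Phi>_def
        by (simp add: S del: One_nat_def diff_diff_left)
    next
      case False
      then show ?thesis
        using I j noupd[OF False] frame
        unfolding relax_body_def I_def \<Phi>_def
        by (simp add: S del: One_nat_def diff_diff_left) blast
    qed
  qed
  show ?thesis
    unfolding relax_def runs_Seq runs_Write
  proof (rule runs_conseq[OF runs_While[where I = I and \<Phi> = \<Phi>]], goal_cases)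
    case 1
    show ?case using best unfolding I_def by (auto simp: start_def extends_def)
  next
    case (2 s')
    then show ?case by (rule step)
  next
    case (3 t s')
    then have I: "I s'" and t: "t \<le> 100 * m + 8" and fin: "\<not> s' ''bin'' 0 + 1 \<le> s' ''m'' 0"
      unfolding \<Phi>_def by auto
    have "s' ''m'' = s ''m''" using I unfolding I_def by simp
    then have m: "s' ''bin'' 0 = m" using I fin \<open>env n s\<close> unfolding I_def env_def by simp
    have "{q. best X i q \<or> extends X i B q} = Collect (best X (Suc i))"
      using best_Suc(1)[OF i(3)] by auto
    then show ?case using I t m bins unfolding I_def by (auto simp: Int_absorb2)
  qed
qed

end

definition bit :: "bool \<Rightarrow> aexp \<Rightarrow> aexp" where
  "bit flip e = (if flip then Sub (Const 1) e else e)"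

definition descend :: com where
  "descend =
     Write ''stack'' (var ''depth'') (var ''item'') ;;
     incr ''depth'' ;;
     Write ''cur'' (var ''item'') (Const 0) ;;
     ''code'' ::= Sub (var ''code'') (Read ''pow'' (var ''item'')) ;;
     ''item'' ::= Const 1"

definition ascend :: com where
  "ascend =
     ''child'' ::= Read ''val'' (var ''code'') ;;
     ''depth'' ::= Sub (var ''depth'') (Const 1) ;;
     ''item'' ::= Read ''stack'' (var ''depth'') ;;
     Write ''cur'' (var ''item'') (Const 1) ;;
     ''code'' ::= Add (var ''code'') (Read ''pow'' (var ''item''))"

text \<open>\<open>dst\<close> runs along the output, as \<open>src\<close> later does along the
  input, because without multiplication the beginning of a row has to be tracked rather than
  computed.\<close>

definition copy_body :: "bool \<Rightarrow> com" where
  "copy_body flip =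
     Write ''out_sets'' (var ''dst'') (bit flip (Read ''cur'' (var ''item''))) ;;
     incr ''dst'' ;;
     incr ''item''"

definition record_answer :: com where
  "record_answer =
     Write ''out_answers'' (var ''out_size'')
       (Sub (Const 1) (Sub (Const 1) (Read ''val'' (var ''code'')))) ;;
     incr ''out_size'' ;;
     Write ''done'' (var ''code'') (Const 1)"

definition finish :: "bool \<Rightarrow> com" where
  "finish flip =
     ''item'' ::= Const 1 ;;
     While (Leq (var ''item'') (var ''n'')) (copy_body flip) ;;
     record_answer"

text \<open>The test for a finished set comes first, so a descent to a set finished earlier is
  followed at once by the return. On return, the scan of the larger set resumes just behind the
  removed item, which was kept on the stack.\<close>

definition visit_body :: "bool \<Rightarrow> com" where
  "visit_body flip =
     Cond (positive (Read ''done'' (var ''code'')))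
       (Cond (positive (var ''depth''))
         (ascend ;; relax ;; incr ''item'')
         (''live'' ::= Const 0))
       (Cond (Leq (var ''item'') (var ''n''))
         (Cond (positive (Read ''cur'' (var ''item''))) descend (incr ''item''))
         (finish flip))"

section \<open>Rows, binary codes and the output of a finished set\<close>

lemma char_vec_nth: "i < n \<Longrightarrow> char_vec n X ! i = of_bool (Suc i \<in> X)"
  unfolding char_vec_def by (simp del: upt_Suc)

lemma length_char_vec [simp]: "length (char_vec n X) = n"
  unfolding char_vec_def by (simp del: upt_Suc)

lemma length_concat_char_vec [simp]: "length (concat (map (char_vec n) Xs)) = length Xs * n"
  by (induction Xs) auto

lemma holds_append:
  "holds s a (xs @ ys) \<longleftrightarrow> holds s a xs \<and> (\<forall>i<length ys. s a (length xs + i) = ys ! i)"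
proof -
  have "(\<forall>i<length xs + length ys. s a i = (xs @ ys) ! i) \<longleftrightarrow>
    (\<forall>i<length xs. s a i = xs ! i) \<and> (\<forall>i<length ys. s a (length xs + i) = ys ! i)" (is "?l \<longleftrightarrow> ?r")
  proof
    assume l: ?l
    show ?r
    proof (intro conjI allI impI)
      fix i assume "i < length xs"
      then show "s a i = xs ! i" using l[rule_format, of i] by (simp add: nth_append)
    next
      fix i assume "i < length ys"
      then show "s a (length xs + i) = ys ! i" using l[rule_format, of "length xs + i"] by simp
    qed
  next
    assume r: ?r
    show ?l
    proof (intro allI impI)
      fix i assume i: "i < length xs + length ys"
      show "s a i = (xs @ ys) ! i"
      proof (cases "i < length xs")
        case False
        then show ?thesis using r i conjunct2[OF r, rule_format, of "i - length xs"]
          by (simp add: nth_append)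
      qed (use r in \<open>simp add: nth_append\<close>)
    qed
  qed
  then show ?thesis unfolding holds_def by simp
qed

lemma set_encode_remove:
  assumes "finite X" "i \<in> X" shows "set_encode X = set_encode (X - {i}) + 2 ^ i"
  using sum.remove[OF assms, of "(^) (2::nat)"] unfolding set_encode_def by simp

lemma set_encode_inject:
  "X \<subseteq> {1..n} \<Longrightarrow> Y \<subseteq> {1..n} \<Longrightarrow> set_encode X = set_encode Y \<longleftrightarrow> X = Y"
  using finite_subset[of _ "{1..n}"] by (intro set_encode_eq) auto

context bin_packing
begin

definition side :: "nat \<Rightarrow> bool \<Rightarrow> nat set \<Rightarrow> nat set" where
  "side n flip X = (if flip then {1..n} - X else X)"

definition current :: "nat \<Rightarrow> nat set \<Rightarrow> store \<Rightarrow> bool" where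
  "current n X s \<longleftrightarrow> X \<subseteq> {1..n} \<and> (\<forall>i\<in>{1..n}. s ''cur'' i = of_bool (i \<in> X)) \<and>
     s ''code'' 0 = set_encode X"

text \<open>\<open>L\<close> lists the finished sets in the order of output, before
  \<open>side\<close> turns them into the sets to be written. \<open>done\<close> is prescribed for
  all subsets, because the search branches on it, but \<open>val\<close> only for finished sets,
  because the values of sets under way are still partial.\<close>

definition table :: "nat \<Rightarrow> bool \<Rightarrow> nat set list \<Rightarrow> store \<Rightarrow> bool" where
  "table n flip L s \<longleftrightarrow> distinct L \<and> set L \<subseteq> Pow {1..n} \<and>
     (\<forall>Y\<subseteq>{1..n}. s ''done'' (set_encode Y) = of_bool (Y \<in> set L)) \<and>
     (\<forall>Y\<in>set L. Collect (fits Y) = above (s ''val'' (set_encode Y))) \<and>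
     s ''out_size'' 0 = length L \<and> s ''dst'' 0 = length L * n \<and>
     holds s ''out_sets'' (concat (map (char_vec n) (map (side n flip) L))) \<and>
     holds s ''out_answers'' (map (\<lambda>Y. if can_divide w c Y B then 1 else 0) L)"

lemma runs_finish:
  assumes "env n s" and cur: "current n X s" and tab: "table n flip L s" and "X \<notin> set L"
    and val: "Collect (fits X) = above (s ''val'' (set_encode X))"
  shows "runs (finish flip) s (\<lambda>t s'. t \<le> 60 * (n + 1) \<and> table n flip (L @ [X]) s' \<and>
    (\<forall>a. a \<notin> {''item'', ''out_sets'', ''dst'', ''out_answers'', ''out_size'', ''done''} \<longrightarrow>
      s' a = s a))"
proof -
  define I where "I s' \<longleftrightarrow> 1 \<le> s' ''item'' 0 \<and> s' ''item'' 0 \<le> n + 1 \<and>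
    s' ''dst'' 0 + 1 = length L * n + s' ''item'' 0 \<and>
    (\<forall>l<length L * n. s' ''out_sets'' l = s ''out_sets'' l) \<and>
    (\<forall>l. l + 1 < s' ''item'' 0 \<longrightarrow>
      s' ''out_sets'' (length L * n + l) = of_bool (Suc l \<in> side n flip X)) \<and>
    (\<forall>a. a \<notin> {''item'', ''out_sets'', ''dst''} \<longrightarrow> s' a = s a)" for s' :: store
  define \<Phi> where "\<Phi> s' = 30 * (n + 1 - s' ''item'' 0)" for s' :: store
  have step: "runs (copy_body flip) s' (\<lambda>t s''. I s'' \<and>
      1 + bcost (Leq (var ''item'') (var ''n'')) + t + \<Phi> s'' \<le> \<Phi> s')"
    if I: "I s'" and b: "bval (Leq (var ''item'') (var ''n'')) s'" for s'
  proof -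
    obtain i where i: "s' ''item'' 0 = i + 1"
      using I unfolding I_def by (metis add.commute le_Suc_ex)
    have same: "s' ''n'' = s ''n''" "s' ''cur'' = s ''cur''"
      using I unfolding I_def by simp_all
    have n: "s ''n'' 0 = n" using \<open>env n s\<close> unfolding env_def by simp
    have i_n: "i + 1 \<le> n" using b i n same by simp
    have dst: "s' ''dst'' 0 = length L * n + i" using I i unfolding I_def by simp
    have bit: "aval (bit flip (Read ''cur'' (var ''item''))) s' = of_bool (Suc i \<in> side n flip X)"
      using cur i same(2) i_n unfolding bit_def side_def current_def by simp
    have cost: "acost (bit flip (Read ''cur'' (var ''item''))) \<le> 5"
      unfolding bit_def by simp
    have time: "30 * (n + 1 - (i + 1)) = 30 * (n + 1 - (i + 2)) + 30" using i_n by simp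
    show ?thesis
      using I cost i_n unfolding copy_body_def I_def \<Phi>_def
      by (simp add: i dst bit time less_Suc_eq)
  qed
  show ?thesis
    unfolding finish_def runs_Seq runs_Write
  proof (rule runs_conseq[OF runs_While[where I = I and \<Phi> = \<Phi>]], goal_cases)
    case 1
    show ?case using tab unfolding I_def table_def by simp
  next
    case (2 s')
    then show ?case by (rule step)
  next
    case (3 t s1)
    then have I: "I s1" and t: "t \<le> 30 * n + 6" and fin: "\<not> s1 ''item'' 0 \<le> s1 ''n'' 0"
      unfolding \<Phi>_def by auto
    have same: "s1 ''n'' = s ''n''" "s1 ''code'' = s ''code''" "s1 ''val'' = s ''val''"
      "s1 ''out_size'' = s ''out_size''" "s1 ''out_answers'' = s ''out_answers''"
      "s1 ''done'' = s ''done''"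
      using I unfolding I_def by simp_all
    have item: "s1 ''item'' 0 = n + 1"
      using I fin same(1) \<open>env n s\<close> unfolding I_def env_def by simp
    have X: "X \<subseteq> {1..n}" "s ''code'' 0 = set_encode X" using cur unfolding current_def by auto
    have size: "s ''out_size'' 0 = length L" using tab unfolding table_def by simp
    have "can_divide w c X B \<longleftrightarrow> Collect (fits X) \<noteq> {}"
      unfolding can_divide_iff_fits by auto
    also have "\<dots> \<longleftrightarrow> 0 < s ''val'' (set_encode X)"
      unfolding val above_def by (auto intro: le_SucI)
    finally have answer: "1 - (1 - s ''val'' (set_encode X)) = (if can_divide w c X B then 1 else 0)"
      by simp
    have "runs record_answer s1 (\<lambda>t s'. t \<le> 20 \<and>
        s' ''out_answers'' = (s ''out_answers'')(length L := if can_divide w c X B then 1 else 0) \<and>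
        s' ''out_size'' 0 = length L + 1 \<and>
        s' ''done'' = (s ''done'')(set_encode X := 1) \<and>
        (\<forall>a. a \<notin> {''out_answers'', ''out_size'', ''done''} \<longrightarrow> s' a = s1 a))"
      unfolding record_answer_def
      by (simp add: same X size answer del: One_nat_def diff_diff_left)
    then show ?case
    proof (rule runs_conseq)
      fix u :: nat and s'
      assume s': "u \<le> 20 \<and>
        s' ''out_answers'' = (s ''out_answers'')(length L := if can_divide w c X B then 1 else 0) \<and>
        s' ''out_size'' 0 = length L + 1 \<and>
        s' ''done'' = (s ''done'')(set_encode X := 1) \<and>
        (\<forall>a. a \<notin> {''out_answers'', ''out_size'', ''done''} \<longrightarrow> s' a = s1 a)"
      have s'1: "s' ''dst'' = s1 ''dst''" "s' ''out_sets'' = s1 ''out_sets''"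
        "s' ''val'' = s ''val''"
        using s' same by simp_all
      have "distinct (L @ [X])" "set (L @ [X]) \<subseteq> Pow {1..n}"
        using tab \<open>X \<notin> set L\<close> X unfolding table_def by auto
      moreover have "\<forall>Y\<subseteq>{1..n}. s' ''done'' (set_encode Y) = of_bool (Y \<in> set (L @ [X]))"
        using tab s' X(1) set_encode_inject unfolding table_def by auto
      moreover have "\<forall>Y\<in>set (L @ [X]). Collect (fits Y) = above (s' ''val'' (set_encode Y))"
        using tab val s'1(3) unfolding table_def by auto
      moreover have "s' ''out_size'' 0 = length (L @ [X])" "s' ''dst'' 0 = length (L @ [X]) * n"
        using s' s'1 I item unfolding I_def by auto
      moreover have "holds s' ''out_sets'' (concat (map (char_vec n) (map (side n flip) (L @ [X]))))"
        using tab I item s'1(2) unfolding I_def table_def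
        by (simp add: holds_append char_vec_nth del: map_map) (simp add: holds_def del: map_map)
      moreover have "holds s' ''out_answers''
          (map (\<lambda>Y. if can_divide w c Y B then 1 else 0) (L @ [X]))"
        using tab s' unfolding table_def by (simp add: holds_append) (simp add: holds_def)
      ultimately have "table n flip (L @ [X]) s'"
        unfolding table_def by blast
      moreover have "\<forall>a. a \<notin> {''item'', ''out_sets'', ''dst'', ''out_answers'', ''out_size'', ''done''}
          \<longrightarrow> s' a = s a"
        using s' I unfolding I_def by auto
      ultimately show "1 + acost (Const 0) + acost (Const 1) + (t + u) \<le> 60 * (n + 1) \<and>
        table n flip (L @ [X]) s' \<and>
        (\<forall>a. a \<notin> {''item'', ''out_sets'', ''dst'', ''out_answers'', ''out_size'', ''done''} \<longrightarrow>
          s' a = s a)"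
        using t s' by simp
    qed
  qed
qed

section \<open>Single moves and complete visits of the depth-first search\<close>

lemma env_frame:
  assumes "env n s" "\<And>a. a \<in> {''n'', ''m'', ''w'', ''c'', ''B'', ''pow''} \<Longrightarrow> s' a = s a"
  shows "env n s'"
  using assms(1) unfolding env_def by (simp add: assms(2))

lemma current_frame:
  assumes "current n X s" "s' ''cur'' = s ''cur''" "s' ''code'' = s ''code''"
  shows "current n X s'"
  using assms unfolding current_def by simp

lemma table_frame:
  assumes "table n flip L s"
    and "\<And>a. a \<in> {''done'', ''out_size'', ''dst'', ''out_sets'', ''out_answers''} \<Longrightarrow> s' a = s a"
    and "\<And>Y. Y \<in> set L \<Longrightarrow> s' ''val'' (set_encode Y) = s ''val'' (set_encode Y)"
  shows "table n flip L s'"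
  using assms(1) unfolding table_def holds_def by (simp add: assms(2,3))

lemma runs_descend:
  assumes "env n s" and cur: "current n X s" and i: "i \<in> X" "s ''item'' 0 = i"
  shows "runs descend s (\<lambda>t s'. t \<le> 40 \<and> current n (X - {i}) s' \<and>
    s' ''item'' 0 = 1 \<and> s' ''depth'' 0 = s ''depth'' 0 + 1 \<and>
    s' ''stack'' = (s ''stack'')(s ''depth'' 0 := i) \<and>
    (\<forall>a. a \<notin> {''stack'', ''depth'', ''cur'', ''code'', ''item''} \<longrightarrow> s' a = s a))"
proof -
  have X: "X \<subseteq> {1..n}" using cur unfolding current_def by simp
  have "finite X" using X by (rule finite_subset) simp
  then have "set_encode X = set_encode (X - {i}) + 2 ^ i" using i(1) by (rule set_encode_remove)
  moreover have "s ''pow'' i = 2 ^ i" using \<open>env n s\<close> X i unfolding env_def by auto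
  ultimately show ?thesis
    using cur i unfolding descend_def current_def
    by (auto simp del: One_nat_def)
qed

lemma runs_ascend:
  assumes "env n s" and cur: "current n (X - {i}) s" and i: "i \<in> X" "X \<subseteq> {1..n}"
    and stack: "s ''depth'' 0 = d + 1" "s ''stack'' d = i"
  shows "runs ascend s (\<lambda>t s'. t \<le> 40 \<and> current n X s' \<and>
    s' ''child'' 0 = s ''val'' (set_encode (X - {i})) \<and> s' ''item'' 0 = i \<and> s' ''depth'' 0 = d \<and>
    (\<forall>a. a \<notin> {''child'', ''depth'', ''item'', ''cur'', ''code''} \<longrightarrow> s' a = s a))"
proof -
  have "finite X" using i(2) by (rule finite_subset) simp
  then have "set_encode X = set_encode (X - {i}) + 2 ^ i" using i(1) by (rule set_encode_remove)
  moreover have "s ''pow'' i = 2 ^ i" using \<open>env n s\<close> i unfolding env_def by auto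
  ultimately show ?thesis
    using cur i stack unfolding ascend_def current_def
    by (auto simp del: One_nat_def)
qed

abbreviation continue :: bexp where
  "continue \<equiv> positive (var ''live'')"

definition searching :: "nat \<Rightarrow> bool \<Rightarrow> nat set list \<Rightarrow> nat set \<Rightarrow> store \<Rightarrow> bool" where
  "searching n flip L X s \<longleftrightarrow>
     env n s \<and> current n X s \<and> table n flip L s \<and> s ''live'' 0 = 1"

lemma searchingD:
  assumes "searching n flip L X s"
  shows "env n s" "current n X s" "table n flip L s" "s ''live'' 0 = 1" "s ''n'' 0 = n"
    "X \<subseteq> {1..n}" "s ''code'' 0 = set_encode X" "s ''done'' (set_encode X) = of_bool (X \<in> set L)"
    "i \<in> {1..n} \<Longrightarrow> s ''cur'' i = of_bool (i \<in> X)"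
  using assms unfolding searching_def current_def table_def env_def by simp_all

lemma visit_skip:
  assumes "searching n flip L X s" "X \<notin> set L" "s ''item'' 0 = i" "i \<in> {1..n}" "i \<notin> X"
  shows "runs (visit_body flip) s (\<lambda>t s'. t \<le> 40 \<and> searching n flip L X s' \<and>
    s' ''item'' 0 = i + 1 \<and> (\<forall>a. a \<noteq> ''item'' \<longrightarrow> s' a = s a))"
proof -
  have code: "s ''done'' (s ''code'' 0) = 0" "s ''cur'' i = 0" "s ''n'' 0 = n"
    using searchingD[OF assms(1)] assms(2-5) by simp_all
  let ?s = "s(''item'' := (s ''item'')(0 := i + 1))"
  note * = searchingD[OF assms(1)]
  have "searching n flip L X ?s"
    unfolding searching_def
  proof (intro conjI)
    show "env n ?s" by (rule env_frame[OF *(1)]) auto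
    show "current n X ?s" by (rule current_frame[OF *(2)]) auto
    show "table n flip L ?s" by (rule table_frame[OF *(3)]) auto
    show "?s ''live'' 0 = 1" using *(4) by simp
  qed
  then show ?thesis
    using code assms(3,4) unfolding visit_body_def by (simp del: One_nat_def)
qed

lemma visit_descend:
  assumes "searching n flip L X s" "X \<notin> set L" "s ''item'' 0 = i" "i \<in> X"
  shows "runs (visit_body flip) s (\<lambda>t s'. t \<le> 70 \<and> searching n flip L (X - {i}) s' \<and>
    s' ''item'' 0 = 1 \<and> s' ''depth'' 0 = s ''depth'' 0 + 1 \<and>
    s' ''stack'' = (s ''stack'')(s ''depth'' 0 := i) \<and>
    (\<forall>a. a \<notin> {''stack'', ''depth'', ''cur'', ''code'', ''item''} \<longrightarrow> s' a = s a))"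
proof -
  note * = searchingD[OF assms(1)]
  have i: "i \<in> {1..n}" using *(6) assms(4) by auto
  then have code: "s ''done'' (s ''code'' 0) = 0" "s ''cur'' i = 1" "s ''n'' 0 = n" "i \<le> n"
    using * assms(2-4) by simp_all
  have "runs descend s (\<lambda>t s'. t \<le> 40 \<and> searching n flip L (X - {i}) s' \<and>
    s' ''item'' 0 = 1 \<and> s' ''depth'' 0 = s ''depth'' 0 + 1 \<and>
    s' ''stack'' = (s ''stack'')(s ''depth'' 0 := i) \<and>
    (\<forall>a. a \<notin> {''stack'', ''depth'', ''cur'', ''code'', ''item''} \<longrightarrow> s' a = s a))"
    using runs_descend[OF *(1,2) assms(4,3)]
  proof (rule runs_conseq, goal_cases)
    case (1 t s')
    have frame: "s' a = s a" if "a \<notin> {''stack'', ''depth'', ''cur'', ''code'', ''item''}" for a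
      using 1 that by simp
    have "env n s'" by (rule env_frame[OF *(1)]) (auto simp: frame)
    moreover have "table n flip L s'" by (rule table_frame[OF *(3)]) (auto simp: frame)
    moreover have "s' ''live'' 0 = 1" using 1 *(4) by simp
    ultimately show ?case using 1 unfolding searching_def by simp
  qed
  then show ?thesis
    unfolding visit_body_def
    by (simp add: code assms(3) del: One_nat_def) (erule runs_conseq, auto)
qed

lemma visit_ascend:
  assumes "searching n flip L (X - {i}) s" "X \<notin> set L" "X - {i} \<in> set L" "i \<in> X" "X \<subseteq> {1..n}"
    and stack: "s ''depth'' 0 = d + 1" "s ''stack'' d = i"
    and best: "Collect (best X i) = above (s ''val'' (set_encode X))"
  shows "runs (visit_body flip) s (\<lambda>t s'. t \<le> 200 * (m + 1) \<and> searching n flip L X s' \<and>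
    s' ''item'' 0 = i + 1 \<and> s' ''depth'' 0 = d \<and>
    Collect (best X (Suc i)) = above (s' ''val'' (set_encode X)) \<and>
    (\<forall>l. l \<noteq> set_encode X \<longrightarrow> s' ''val'' l = s ''val'' l) \<and> s' ''stack'' = s ''stack'')"
proof -
  note * = searchingD[OF assms(1)]
  have code: "s ''done'' (s ''code'' 0) = 1"
    using *(7,8) assms(3) by simp
  have child: "Collect (fits (X - {i})) = above (s ''val'' (set_encode (X - {i})))"
    using *(3) assms(3) unfolding table_def by auto
  have "runs (ascend ;; relax ;; incr ''item'') s (\<lambda>t s'. t \<le> 170 * (m + 1) \<and>
    searching n flip L X s' \<and> s' ''item'' 0 = i + 1 \<and> s' ''depth'' 0 = d \<and>
    Collect (best X (Suc i)) = above (s' ''val'' (set_encode X)) \<and>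
    (\<forall>l. l \<noteq> set_encode X \<longrightarrow> s' ''val'' l = s ''val'' l) \<and> s' ''stack'' = s ''stack'')"
    unfolding runs_Seq
  proof (rule runs_conseq[OF runs_ascend[OF *(1,2) assms(4,5) stack]], goal_cases)
    case (1 t s1)
    have frame1: "s1 a = s a" if "a \<notin> {''child'', ''depth'', ''item'', ''cur'', ''code''}" for a
      using 1 that by simp
    have "env n s1" by (rule env_frame[OF *(1)]) (auto simp: frame1)
    then have s1: "env n s1" "s1 ''val'' = s ''val''" "s1 ''code'' 0 = set_encode X"
      using 1 frame1 unfolding current_def by simp_all
    have "s1 ''item'' 0 = i" using 1 by simp
    moreover have "i \<in> {1..n}" using assms(4,5) by blast
    ultimately have i: "s1 ''item'' 0 = i" "i \<in> {1..n}" .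
    show ?case
    proof (rule runs_conseq[OF runs_relax[OF s1(1) i assms(4) _ s1(3)]], goal_cases)
      case u: 1
      show ?case using child 1 by simp
    next
      case 2
      then show ?case using best s1(2) by simp
    next
      case (3 u s2)
      let ?s = "s2(''item'' := (s2 ''item'')(0 := i + 1))"
      have frame: "?s a = s a"
        if "a \<notin> {''start'', ''bin'', ''pos'', ''val'', ''child'', ''depth'', ''item'', ''cur'', ''code''}"
        for a using that frame1 3 by simp
      have val: "?s ''val'' l = s ''val'' l" if "l \<noteq> set_encode X" for l
        using that 3 s1(2) by simp
      have "env n ?s" by (rule env_frame[OF *(1)], rule frame) auto
      moreover have "current n X ?s" using 1 3 unfolding current_def by simp
      moreover have "table n flip L ?s"
      proof (rule table_frame[OF *(3)])
        show "?s a = s a" if "a \<in> {''done'', ''out_size'', ''dst'', ''out_sets'', ''out_answers''}" for a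
          using that by (intro frame) auto
        \<comment> \<open>The relaxation overwrote only the entry of \<open>X\<close>, which is not
          finished; injectivity of the codes protects the entries of the finished sets.\<close>
        show "?s ''val'' (set_encode Y) = s ''val'' (set_encode Y)" if "Y \<in> set L" for Y
          using that assms(2,5) *(3) set_encode_inject[of Y n X] unfolding table_def
          by (intro val) auto
      qed
      moreover have "?s ''live'' 0 = 1" using frame[of "''live''"] *(4) by simp
      ultimately have "searching n flip L X ?s" unfolding searching_def by simp
      moreover have "?s ''stack'' = s ''stack''" by (rule frame) simp
      moreover have "?s ''depth'' 0 = d" using 1 3 by simp
      moreover have "s2 ''item'' 0 = i" using 1 3 by simp
      ultimately show ?case using 1 3 val by simp
    qed
  qed
  then show ?thesis
    unfolding visit_body_def runs_Cond
    by (simp add: code stack(1) del: One_nat_def runs_Seq)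
      (erule runs_conseq, auto)
qed

lemma visit_finish:
  assumes "searching n flip L X s" "X \<notin> set L" "s ''item'' 0 = n + 1"
    and best: "Collect (best X (Suc n)) = above (s ''val'' (set_encode X))"
  shows "runs (visit_body flip) s (\<lambda>t s'. t \<le> 90 * (n + 1) \<and> searching n flip (L @ [X]) X s' \<and>
    s' ''depth'' = s ''depth'' \<and> s' ''stack'' = s ''stack'' \<and> s' ''val'' = s ''val'')"
proof -
  note * = searchingD[OF assms(1)]
  have code: "s ''done'' (s ''code'' 0) = 0" "s ''n'' 0 = n" and X: "X \<subseteq> {1..n}"
    using * assms(2,3) by simp_all
  have "runs (finish flip) s (\<lambda>t s'. t \<le> 60 * (n + 1) \<and> searching n flip (L @ [X]) X s' \<and>
    s' ''depth'' = s ''depth'' \<and> s' ''stack'' = s ''stack'' \<and> s' ''val'' = s ''val'')"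
    using runs_finish[OF *(1-3) assms(2) best[unfolded best_all[OF X]]]
  proof (rule runs_conseq, goal_cases)
    case (1 t s')
    have frame: "s' a = s a" if "a \<notin> {''item'', ''out_sets'', ''dst'', ''out_answers'', ''out_size'', ''done''}" for a
      using 1 that by simp
    have "env n s'" by (rule env_frame[OF *(1)]) (auto simp: frame)
    moreover have "current n X s'" by (rule current_frame[OF *(2)]) (auto simp: frame)
    moreover have "s' ''live'' 0 = 1" using 1 *(4) by simp
    ultimately show ?case using 1 unfolding searching_def by simp
  qed
  then show ?thesis
    unfolding visit_body_def
    by (simp add: code assms(3) del: One_nat_def) (erule runs_conseq, auto)
qed

text \<open>The net effect of a complete visit of \<open>X\<close>. The stack below the current
  depth and the values outside \<open>Pow X\<close> must survive because they belong to interrupted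
  visits of larger sets.\<close>

definition walk ::
    "nat \<Rightarrow> bool \<Rightarrow> nat set list \<Rightarrow> nat set \<Rightarrow> store \<Rightarrow> nat \<Rightarrow> nat set list \<Rightarrow> store \<Rightarrow> bool" where
  "walk n flip L X s t L' s' \<longleftrightarrow>
     reach continue (visit_body flip) s t s' \<and> searching n flip L' X s' \<and>
     set L' = set L \<union> Pow X \<and> s' ''depth'' 0 = s ''depth'' 0 \<and>
     (\<forall>e<s ''depth'' 0. s' ''stack'' e = s ''stack'' e) \<and>
     (\<forall>Y\<subseteq>{1..n}. \<not> Y \<subseteq> X \<longrightarrow> s' ''val'' (set_encode Y) = s ''val'' (set_encode Y))"

text \<open>The constant 5 is \<open>1 + bcost continue\<close>, the price of one successful test of
  the guard.\<close>

lemma reach_continue: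
  assumes "searching n flip L X s" "runs (visit_body flip) s Q"
  obtains t s' where "reach continue (visit_body flip) s (5 + t) s'" "Q t s'"
proof -
  have "bval continue s" using searchingD(4)[OF assms(1)] by simp
  then obtain t s' where "reach continue (visit_body flip) s (1 + bcost continue + t) s'" "Q t s'"
    using assms(2) by (rule runs_reach)
  then show thesis using that[of t s'] by (simp add: eval_nat_numeral)
qed

text \<open>The initial value of the empty set is \<open>1\<close>, since it fits below position \<open>0\<close>.\<close>

lemma sweep:
  assumes visit: "\<And>Y L s. Y \<subset> X \<Longrightarrow> searching n flip L Y s \<Longrightarrow> s ''item'' 0 = 1 \<Longrightarrow>
      \<forall>Z\<in>set L. Pow Z \<subseteq> set L \<Longrightarrow>
      \<forall>Z\<subseteq>Y. Z \<notin> set L \<longrightarrow> s ''val'' (set_encode Z) = of_bool (Z = {}) \<Longrightarrow>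
      \<exists>t L' s'. walk n flip L Y s t L' s' \<and> t \<le> K * card (Pow Y - set L)"
    and "searching n flip L X s" "X \<notin> set L" "s ''item'' 0 = i" "1 \<le> i" "i \<le> n + 1"
    and "\<forall>Z\<in>set L. Pow Z \<subseteq> set L" "\<forall>k\<in>X. k < i \<longrightarrow> X - {k} \<in> set L"
    and "\<forall>Z\<subset>X. Z \<notin> set L \<longrightarrow> s ''val'' (set_encode Z) = of_bool (Z = {})"
    and "Collect (best X i) = above (s ''val'' (set_encode X))"
  shows "\<exists>t L' s'. walk n flip L X s t L' s' \<and>
    t \<le> 400 * (m + 1) * (n + 1 - i) + 150 * (n + 1) + K * card (Pow X - {X} - set L)"
  using assms(2-)
\<comment> \<open>The assumption \<open>visit\<close> stays outside this induction; it will be the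
  induction hypothesis of a recursion on the size of \<open>X\<close>. Each item costs at most
  \<open>400 * (m + 1)\<close> for descent, return and relaxation, \<open>150 * (n + 1)\<close> pays
  for finishing \<open>X\<close>, and \<open>K\<close> is paid once for every proper subset newly
  finished.\<close>
proof (induction "n + 1 - i" arbitrary: i L s)
  case 0
  note prems = "0.prems" and D = searchingD[OF "0.prems"(1)]
  have i: "i = n + 1" using "0.hyps" prems(5) by simp
  have item: "s ''item'' 0 = n + 1" using prems(3) i by simp
  have best: "Collect (best X (Suc n)) = above (s ''val'' (set_encode X))"
    using prems(9) i by simp
  obtain t s' where r: "reach continue (visit_body flip) s (5 + t) s'"
    and s': "t \<le> 90 * (n + 1) \<and> searching n flip (L @ [X]) X s' \<and>
      s' ''depth'' = s ''depth'' \<and> s' ''stack'' = s ''stack'' \<and> s' ''val'' = s ''val''"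
    using reach_continue[OF prems(1) visit_finish[OF prems(1,2) item best]] .
  \<comment> \<open>A proper subset misses some item \<open>k\<close> of \<open>X\<close>, hence
    lies below \<open>X - {k}\<close>. That set is finished, and the finished sets are closed under
    subsets.\<close>
  have "Y \<in> set L" if Y: "Y \<subset> X" for Y
  proof -
    obtain k where k: "k \<in> X" "k \<notin> Y" using Y by blast
    then have "k < i" using D(6) i by auto
    then have "X - {k} \<in> set L" using prems(7) k(1) by simp
    moreover have "Y \<subseteq> X - {k}" using Y k(2) by blast
    ultimately show ?thesis using prems(6) by blast
  qed
  then have "set (L @ [X]) = set L \<union> Pow X" by auto
  then have "walk n flip L X s (5 + t) (L @ [X]) s'"
    unfolding walk_def using r s' by simp
  moreover have "5 + t \<le> 150 * (n + 1)" using s' by simp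
  ultimately show ?case using i by (intro exI conjI) auto
next
  case (Suc r i L s)
  note prems = Suc.prems and D = searchingD[OF Suc.prems(1)]
  have i: "i \<in> {1..n}" and r: "r = n + 1 - (i + 1)" and ir: "n + 1 - i = (n + 1 - (i + 1)) + 1"
    using Suc.hyps(2) prems(4) by auto
  have i1: "1 \<le> i + 1" "i + 1 \<le> n + 1" using i by auto
  show ?case
  proof (cases "i \<in> X")
    case False
    obtain t s' where r1: "reach continue (visit_body flip) s (5 + t) s'"
      and s': "t \<le> 40 \<and> searching n flip L X s' \<and> s' ''item'' 0 = i + 1 \<and>
        (\<forall>a. a \<noteq> ''item'' \<longrightarrow> s' a = s a)"
      using reach_continue[OF prems(1) visit_skip[OF prems(1,2,3) i False]] .
    have same: "s' ''val'' = s ''val''" "s' ''depth'' = s ''depth''" "s' ''stack'' = s ''stack''"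
      using s' by simp_all
    have below: "\<forall>k\<in>X. k < i + 1 \<longrightarrow> X - {k} \<in> set L"
      using prems(7) False by (metis Suc_eq_plus1 less_Suc_eq)
    have best: "Collect (best X (i + 1)) = above (s' ''val'' (set_encode X))"
      using prems(9) best_Suc(2)[OF False] same by simp
    have fresh: "\<forall>Z\<subset>X. Z \<notin> set L \<longrightarrow> s' ''val'' (set_encode Z) = of_bool (Z = {})"
      using prems(8) same by simp
    have search: "searching n flip L X s'" "s' ''item'' 0 = i + 1" using s' by auto
    obtain u L' s'' where w: "walk n flip L X s' u L' s''" and u: "u \<le>
        400 * (m + 1) * (n + 1 - (i + 1)) + 150 * (n + 1) + K * card (Pow X - {X} - set L)"
      using Suc.hyps(1)[OF r search(1) prems(2) search(2) i1 prems(6) below fresh best] by blast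
    have "walk n flip L X s (5 + t + u) L' s''"
      using w reach_trans[OF r1] unfolding walk_def same by simp
    moreover have "5 + t + u \<le>
        400 * (m + 1) * (n + 1 - i) + 150 * (n + 1) + K * card (Pow X - {X} - set L)"
      using u s' unfolding ir by (simp add: algebra_simps)
    ultimately show ?thesis by blast
  next
    case True
    define d where "d = s ''depth'' 0"
    obtain t1 s1 where r1: "reach continue (visit_body flip) s (5 + t1) s1"
      and s1: "t1 \<le> 70 \<and> searching n flip L (X - {i}) s1 \<and>
        s1 ''item'' 0 = 1 \<and> s1 ''depth'' 0 = s ''depth'' 0 + 1 \<and>
        s1 ''stack'' = (s ''stack'')(s ''depth'' 0 := i) \<and>
        (\<forall>a. a \<notin> {''stack'', ''depth'', ''cur'', ''code'', ''item''} \<longrightarrow> s1 a = s a)"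
      using reach_continue[OF prems(1) visit_descend[OF prems(1,2,3) True]] .
    have val1: "s1 ''val'' = s ''val''" using s1 by simp
    have sub: "X - {i} \<subset> X" using True by blast
    have search1: "searching n flip L (X - {i}) s1" "s1 ''item'' 0 = 1" using s1 by auto
    have fresh1: "\<forall>Z\<subseteq>X - {i}. Z \<notin> set L \<longrightarrow> s1 ''val'' (set_encode Z) = of_bool (Z = {})"
      using prems(8) sub unfolding val1 by (meson subset_psubset_trans)
    obtain t2 L2 s2 where w2: "walk n flip L (X - {i}) s1 t2 L2 s2"
      and t2: "t2 \<le> K * card (Pow (X - {i}) - set L)"
      using visit[OF sub search1 prems(6) fresh1] by blast
    have r2: "reach continue (visit_body flip) s1 t2 s2" and search2: "searching n flip L2 (X - {i}) s2"
      and L2: "set L2 = set L \<union> Pow (X - {i})" and depth2: "s2 ''depth'' 0 = d + 1"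
      using w2 s1 unfolding walk_def d_def by simp_all
    have stack2: "s2 ''stack'' d = i" "\<forall>e<d. s2 ''stack'' e = s ''stack'' e"
      using w2 s1 unfolding walk_def d_def by simp_all
    have val2: "s2 ''val'' (set_encode Y) = s ''val'' (set_encode Y)"
      if "Y \<subseteq> {1..n}" "\<not> Y \<subseteq> X - {i}" for Y
      using w2 that val1 unfolding walk_def by simp
    \<comment> \<open>The partial value of \<open>X\<close> survives the visit of
      \<open>X - {i}\<close>, which only touches values of subsets of
      \<open>X - {i}\<close>.\<close>
    have "\<not> X \<subseteq> X - {i}" using True by blast
    then have best2: "Collect (best X i) = above (s2 ''val'' (set_encode X))"
      using val2[OF D(6)] prems(9) by simp
    have X2: "X \<notin> set L2" "X - {i} \<in> set L2" using L2 prems(2) True by auto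
    obtain t3 s3 where r3: "reach continue (visit_body flip) s2 (5 + t3) s3"
      and s3: "t3 \<le> 200 * (m + 1) \<and> searching n flip L2 X s3 \<and>
        s3 ''item'' 0 = i + 1 \<and> s3 ''depth'' 0 = d \<and>
        Collect (best X (Suc i)) = above (s3 ''val'' (set_encode X)) \<and>
        (\<forall>l. l \<noteq> set_encode X \<longrightarrow> s3 ''val'' l = s2 ''val'' l) \<and> s3 ''stack'' = s2 ''stack''"
      using reach_continue[OF search2
          visit_ascend[OF search2 X2 True D(6) depth2 stack2(1) best2]] .
    have val3: "s3 ''val'' (set_encode Y) = s ''val'' (set_encode Y)"
      if "Y \<subseteq> {1..n}" "\<not> Y \<subseteq> X - {i}" "Y \<noteq> X" for Y
      using s3 that val2 set_encode_inject[OF that(1) D(6)] by simp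
    have search3: "searching n flip L2 X s3" "s3 ''item'' 0 = i + 1" using s3 by auto
    have down: "\<forall>Z\<in>set L2. Pow Z \<subseteq> set L2" using prems(6) L2 by auto
    have below: "\<forall>k\<in>X. k < i + 1 \<longrightarrow> X - {k} \<in> set L2"
      using prems(7) X2(2) L2 by (metis Suc_eq_plus1 Un_iff less_Suc_eq)
    \<comment> \<open>A proper subset of \<open>X\<close> that is still unfinished contains
      \<open>i\<close>, so the visit of \<open>X - {i}\<close> left its value alone, and the
      relaxation changed only the value of \<open>X\<close>.\<close>
    have fresh3: "\<forall>Z\<subset>X. Z \<notin> set L2 \<longrightarrow> s3 ''val'' (set_encode Z) = of_bool (Z = {})"
    proof (intro allI impI)
      fix Z assume Z: "Z \<subset> X" "Z \<notin> set L2"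
      then have "\<not> Z \<subseteq> X - {i}" "Z \<subseteq> {1..n}" "Z \<notin> set L" using L2 D(6) by auto
      then show "s3 ''val'' (set_encode Z) = of_bool (Z = {})" using val3[of Z] prems(8) Z(1) by simp
    qed
    have best3: "Collect (best X (i + 1)) = above (s3 ''val'' (set_encode X))" using s3 by simp
    obtain t4 L4 s4 where w4: "walk n flip L2 X s3 t4 L4 s4" and t4: "t4 \<le>
        400 * (m + 1) * (n + 1 - (i + 1)) + 150 * (n + 1) + K * card (Pow X - {X} - set L2)"
      using Suc.hyps(1)[OF r search3(1) X2(1) search3(2) i1 down below fresh3 best3] by blast
    have "walk n flip L X s (5 + t1 + t2 + (5 + t3) + t4) L4 s4"
      unfolding walk_def
    proof (intro conjI)
      show "reach continue (visit_body flip) s (5 + t1 + t2 + (5 + t3) + t4) s4"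
        using w4 reach_trans[OF reach_trans[OF reach_trans[OF r1 r2] r3]] unfolding walk_def by blast
      show "searching n flip L4 X s4" using w4 unfolding walk_def by blast
      show "set L4 = set L \<union> Pow X" using w4 L2 unfolding walk_def by auto
      show "s4 ''depth'' 0 = s ''depth'' 0" using w4 s3 unfolding walk_def d_def by simp
      show "\<forall>e<s ''depth'' 0. s4 ''stack'' e = s ''stack'' e"
        using w4 s3 stack2(2) unfolding walk_def d_def by simp
      show "\<forall>Y\<subseteq>{1..n}. \<not> Y \<subseteq> X \<longrightarrow> s4 ''val'' (set_encode Y) = s ''val'' (set_encode Y)"
      proof (intro allI impI)
        fix Y assume Y: "Y \<subseteq> {1..n}" "\<not> Y \<subseteq> X"
        then have "s4 ''val'' (set_encode Y) = s3 ''val'' (set_encode Y)"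
          using w4 unfolding walk_def by simp
        also have "\<dots> = s ''val'' (set_encode Y)" using Y by (intro val3) auto
        finally show "s4 ''val'' (set_encode Y) = s ''val'' (set_encode Y)" .
      qed
    qed
    \<comment> \<open>The sets finished below \<open>X - {i}\<close> and those left for the
      remaining items are disjoint, so no set is charged twice.\<close>
    moreover have "card (Pow X - {X} - set L) =
        card (Pow (X - {i}) - set L) + card (Pow X - {X} - set L2)"
    proof -
      have "finite X" using D(6) by (rule finite_subset) simp
      moreover have "Pow X - {X} - set L = (Pow (X - {i}) - set L) \<union> (Pow X - {X} - set L2)"
        using L2 True by auto
      ultimately show ?thesis using L2 by (simp add: card_Un_disjoint disjoint_iff)
    qed
    then have "5 + t1 + t2 + (5 + t3) + t4 \<le>
        400 * (m + 1) * (n + 1 - i) + 150 * (n + 1) + K * card (Pow X - {X} - set L)"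
      using t2 t4 s1 s3 unfolding ir by (simp add: algebra_simps)
    ultimately show ?thesis by blast
  qed
qed

text \<open>Recursion on the size of \<open>X\<close>, with \<open>sweep\<close> as the body of the
  recursive call. A visit of a finished set takes no time at all: the return from it is paid for by
  the larger set.\<close>

lemma visit:
  assumes "searching n flip L X s" "s ''item'' 0 = 1" "\<forall>Z\<in>set L. Pow Z \<subseteq> set L"
    and "\<forall>Z\<subseteq>X. Z \<notin> set L \<longrightarrow> s ''val'' (set_encode Z) = of_bool (Z = {})"
  shows "\<exists>t L' s'. walk n flip L X s t L' s' \<and>
    t \<le> 600 * (m + 1) * (n + 1) * card (Pow X - set L)"
  using assms
proof (induction "card X" arbitrary: X L s rule: less_induct)
  case less
  note prems = less.prems and D = searchingD[OF less.prems(1)]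
  let ?K = "600 * (m + 1) * (n + 1)"
  have fin: "finite X" using D(6) by (rule finite_subset) simp
  show ?case
  proof (cases "X \<in> set L")
    case True
    then have "set L = set L \<union> Pow X" using prems(3) by blast
    then have "walk n flip L X s 0 L s"
      unfolding walk_def using prems(1) reach_refl by auto
    then show ?thesis by (intro exI conjI) auto
  next
    case False
    have sub: "\<exists>t L' s'. walk n flip L Y s t L' s' \<and> t \<le> ?K * card (Pow Y - set L)"
      if "Y \<subset> X" "searching n flip L Y s" "s ''item'' 0 = 1" "\<forall>Z\<in>set L. Pow Z \<subseteq> set L"
        "\<forall>Z\<subseteq>Y. Z \<notin> set L \<longrightarrow> s ''val'' (set_encode Z) = of_bool (Z = {})" for Y L s
      using less.hyps[OF psubset_card_mono[OF fin that(1)] that(2-5)] .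
    have best: "Collect (best X 1) = above (s ''val'' (set_encode X))"
      using best_first[OF D(6)] prems(4) False by simp
    have below: "\<forall>k\<in>X. k < 1 \<longrightarrow> X - {k} \<in> set L" using D(6) by auto
    have fresh: "\<forall>Z\<subset>X. Z \<notin> set L \<longrightarrow> s ''val'' (set_encode Z) = of_bool (Z = {})"
      using prems(4) by (simp add: psubset_imp_subset)
    have one: "(1::nat) \<le> 1" "1 \<le> n + 1" by auto
    obtain t L' s' where w: "walk n flip L X s t L' s'" and t: "t \<le>
        400 * (m + 1) * (n + 1 - 1) + 150 * (n + 1) + ?K * card (Pow X - {X} - set L)"
      using sweep[OF sub prems(1) False prems(2) one prems(3) below fresh best] by blast
    have "Pow X - set L = insert X (Pow X - {X} - set L)" using False by auto
    then have "card (Pow X - set L) = card (Pow X - {X} - set L) + 1" using fin by simp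
    \<comment> \<open>The constant 600 covers the cost of \<open>X\<close> itself, at most
      \<open>400 * (m + 1) * n + 150 * (n + 1)\<close>; this is the share of the one additional set
      counted here.\<close>
    then have "t \<le> ?K * card (Pow X - set L)" using t by (simp add: algebra_simps)
    with w show ?thesis by blast
  qed
qed

end

section \<open>Reading the family and looping over its members\<close>

definition load_body :: "bool \<Rightarrow> com" where
  "load_body flip =
     Write ''cur'' (var ''item'') (bit flip (Read ''family'' (var ''src''))) ;;
     Cond (positive (Read ''cur'' (var ''item'')))
       (''code'' ::= Add (var ''code'') (Read ''pow'' (var ''item'')))
       Skip ;;
     incr ''src'' ;;
     incr ''item''"

definition load :: "bool \<Rightarrow> com" where
  "load flip =
     ''code'' ::= Const 0 ;;
     ''item'' ::= Const 1 ;;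
     While (Leq (var ''item'') (var ''n'')) (load_body flip)"

definition search :: "bool \<Rightarrow> com" where
  "search flip =
     load flip ;;
     (''depth'' ::= Const 0 ;; ''live'' ::= Const 1 ;; ''item'' ::= Const 1) ;;
     While (positive (var ''live'')) (visit_body flip)"

definition powers_body :: com where
  "powers_body =
     Write ''pow'' (var ''item'')
       (Add (Read ''pow'' (Sub (var ''item'') (Const 1))) (Read ''pow'' (Sub (var ''item'') (Const 1)))) ;;
     incr ''item''"

text \<open>Address 0 of \<open>val\<close> is the code of the empty set, whose value is the only
  one that does not start at zero. The powers of two are tabulated by doubling, since the machine
  cannot multiply.\<close>

definition init :: com where
  "init =
     Write ''val'' (Const 0) (Const 1) ;;
     Write ''pow'' (Const 0) (Const 1) ;;
     ''item'' ::= Const 1 ;;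
     While (Leq (var ''item'') (var ''n'')) powers_body"

text \<open>An empty family has an empty closure, so only constant time is allowed for it; the outer
  test avoids tabulating the powers in that case.\<close>

definition program :: "bool \<Rightarrow> com" where
  "program flip =
     Cond (positive (var ''family_size''))
       (init ;;
        While (Leq (Add (var ''row'') (Const 1)) (var ''family_size'')) (search flip ;; incr ''row''))
       Skip"

lemma reach_frame: "reach b p s t s' \<Longrightarrow> a \<notin> writes p \<Longrightarrow> s' a = s a"
  by (induction rule: reach.induct) (simp_all add: exec_writes)

lemma visit_body_writes:
  "writes (visit_body flip) = {''child'', ''depth'', ''item'', ''cur'', ''code'', ''start'', ''bin'',
     ''pos'', ''val'', ''live'', ''stack'', ''out_sets'', ''dst'', ''out_answers'', ''out_size'', ''done''}"
  unfolding visit_body_def ascend_def relax_def relax_body_def descend_def finish_def copy_body_def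
    record_answer_def by auto

lemma runs_reach_While:
  assumes "reach b p s t s'" "runs (While b p) s' (\<lambda>u. Q (t + u))"
  shows "runs (While b p) s Q"
  using assms(2) reach_exec[OF assms(1)] unfolding runs_def by blast

lemma concat_char_vec_nth:
  "k < length Ws \<Longrightarrow> i < n \<Longrightarrow>
    concat (map (char_vec n) Ws) ! (k * n + i) = of_bool (Suc i \<in> Ws ! k)"
proof (induction Ws arbitrary: k)
  case (Cons W Ws)
  then show ?case by (cases k) (simp_all add: nth_append char_vec_nth add.assoc)
qed simp

lemma concat_index_less: "k < N \<Longrightarrow> i < n \<Longrightarrow> k * n + i < N * (n :: nat)"
  by (metis mod_less_divisor mult.commute mult_Suc_right nat_add_left_cancel_less
      less_le_trans add.commute mult_le_mono1 Suc_leI)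

context bin_packing
begin

lemma runs_load:
  assumes "env n s" "W \<subseteq> {1..n}"
    and row: "\<And>i. i < n \<Longrightarrow> s ''family'' (s ''src'' 0 + i) = of_bool (Suc i \<in> W)"
  shows "runs (load flip) s (\<lambda>t s'. t \<le> 60 * (n + 1) \<and> current n (side n flip W) s' \<and>
    s' ''src'' 0 = s ''src'' 0 + n \<and>
    (\<forall>a. a \<notin> {''code'', ''item'', ''cur'', ''src''} \<longrightarrow> s' a = s a))"
proof -
  let ?X = "side n flip W"
  define I where "I s' \<longleftrightarrow> 1 \<le> s' ''item'' 0 \<and> s' ''item'' 0 \<le> n + 1 \<and>
    s' ''src'' 0 + 1 = s ''src'' 0 + s' ''item'' 0 \<and>
    (\<forall>k. 1 \<le> k \<and> k < s' ''item'' 0 \<longrightarrow> s' ''cur'' k = of_bool (k \<in> ?X)) \<and>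
    s' ''code'' 0 = set_encode (?X \<inter> {1..<s' ''item'' 0}) \<and>
    (\<forall>a. a \<notin> {''code'', ''item'', ''cur'', ''src''} \<longrightarrow> s' a = s a)" for s' :: store
  define \<Phi> where "\<Phi> s' = 50 * (n + 1 - s' ''item'' 0)" for s' :: store
  have step: "runs (load_body flip) s' (\<lambda>t s''. I s'' \<and>
      1 + bcost (Leq (var ''item'') (var ''n'')) + t + \<Phi> s'' \<le> \<Phi> s')"
    if I: "I s'" and b: "bval (Leq (var ''item'') (var ''n'')) s'" for s'
  proof -
    obtain i where i: "s' ''item'' 0 = i + 1"
      using I unfolding I_def by (metis add.commute le_Suc_ex)
    have same: "s' ''n'' = s ''n''" "s' ''family'' = s ''family''" "s' ''pow'' = s ''pow''"
      using I unfolding I_def by simp_all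
    have n: "s ''n'' 0 = n" using \<open>env n s\<close> unfolding env_def by simp
    have i_n: "i + 1 \<le> n" using b i n same by simp
    have src: "s' ''src'' 0 = s ''src'' 0 + i" using I i unfolding I_def by simp
    have pow: "s ''pow'' (i + 1) = 2 ^ (i + 1)"
      using \<open>env n s\<close> i_n unfolding env_def by simp
    have bit: "aval (bit flip (Read ''family'' (var ''src''))) s' = of_bool (i + 1 \<in> ?X)"
      using row[of i] same(2) src i_n unfolding bit_def side_def by simp
    have cost: "acost (bit flip (Read ''family'' (var ''src''))) \<le> 5"
      unfolding bit_def by simp
    have time: "50 * (n - i) = 50 * (n - (i + 1)) + 50" using i_n by simp
    have ivl: "{1..<i + 1 + 1} = insert (i + 1) {1..<i + 1}" by auto
    have enc: "set_encode (?X \<inter> {1..<i + 1 + 1}) =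
        (if i + 1 \<in> ?X then set_encode (?X \<inter> {1..<i + 1}) + 2 ^ (i + 1)
         else set_encode (?X \<inter> {1..<i + 1}))"
      unfolding ivl by simp
    have code: "s' ''code'' 0 = set_encode (?X \<inter> {1..<i + 1})" using I i unfolding I_def by simp
    have cur: "s' ''cur'' k = of_bool (k \<in> ?X)" if "1 \<le> k" "k < i + 1" for k
      using I i that unfolding I_def by simp
    have frame: "\<forall>a. a \<notin> {''code'', ''item'', ''cur'', ''src''} \<longrightarrow> s' a = s a"
      using I unfolding I_def by blast
    show ?thesis
    proof (cases "i + 1 \<in> ?X")
      case True
      then show ?thesis
        using cost i_n cur frame unfolding load_body_def I_def \<Phi>_def
        by (simp add: i src bit time enc pow code less_Suc_eq del: One_nat_def power_Suc)
    next
      case False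
      then show ?thesis
        using cost i_n cur frame unfolding load_body_def I_def \<Phi>_def
        by (simp add: i src bit time enc pow code less_Suc_eq del: One_nat_def power_Suc)
    qed
  qed
  show ?thesis
    unfolding load_def runs_Seq runs_Write
  proof (rule runs_conseq[OF runs_While[where I = I and \<Phi> = \<Phi>]], goal_cases)
    case 1
    show ?case unfolding I_def by simp
  next
    case (2 s')
    then show ?case by (rule step)
  next
    case (3 t s1)
    then have I: "I s1" and t: "t \<le> 50 * n + 6" and fin: "\<not> s1 ''item'' 0 \<le> s1 ''n'' 0"
      unfolding \<Phi>_def by auto
    have "s1 ''n'' = s ''n''" using I unfolding I_def by simp
    then have item: "s1 ''item'' 0 = n + 1"
      using I fin \<open>env n s\<close> unfolding I_def env_def by simp
    have X: "?X \<subseteq> {1..n}" using assms(2) unfolding side_def by auto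
    then have "?X \<inter> {1..<n + 1} = ?X" by auto
    then have "current n ?X s1" using I X item unfolding I_def current_def by simp
    then show ?case using I t item unfolding I_def by simp
  qed
qed

text \<open>Meant for the moments between two searches, when no visit is interrupted and hence no
  unfinished set has a partial value.\<close>

definition fresh :: "nat \<Rightarrow> nat set list \<Rightarrow> store \<Rightarrow> bool" where
  "fresh n L s \<longleftrightarrow>
     (\<forall>Y\<subseteq>{1..n}. Y \<notin> set L \<longrightarrow> s ''val'' (set_encode Y) = of_bool (Y = {}))"

text \<open>A walk stays inside the loop. This is the round that ends it: the root is finished and
  the stack is empty.\<close>

lemma visit_exit:
  assumes "searching n flip L X s" "X \<in> set L" "s ''depth'' 0 = 0"
  shows "runs (While continue (visit_body flip)) s
    (\<lambda>t s'. t \<le> 40 \<and> s' = s(''live'' := (s ''live'')(0 := 0)))"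
proof -
  note D = searchingD[OF assms(1)]
  let ?s = "s(''live'' := (s ''live'')(0 := 0))"
  have "runs (visit_body flip) s (\<lambda>t s'. t \<le> 20 \<and> s' = ?s)"
    unfolding visit_body_def using D(7,8) assms(2,3) by (simp del: One_nat_def)
  then obtain t where t: "exec (visit_body flip) s t ?s" "t \<le> 20" unfolding runs_def by blast
  have "exec (While continue (visit_body flip)) ?s (1 + bcost continue) ?s"
    by (rule exec.WhileFalse) simp
  from exec.WhileTrue[OF _ t(1) this]
  have "exec (While continue (visit_body flip)) s (1 + bcost continue + t + (1 + bcost continue)) ?s"
    using D(4) by simp
  then show ?thesis
    unfolding runs_def using t(2) by (intro exI conjI) auto
qed

text \<open>Finished sets carry over from one search to the next, so only the new part of the power
  set is paid for. The term \<open>150 * (n + 1)\<close> covers loading the row, resetting the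
  scalars and leaving the loop.\<close>

lemma runs_search:
  assumes "env n s" "table n flip L s" "fresh n L s" "\<forall>Z\<in>set L. Pow Z \<subseteq> set L"
    and W: "W \<subseteq> {1..n}"
    and row: "\<And>i. i < n \<Longrightarrow> s ''family'' (s ''src'' 0 + i) = of_bool (Suc i \<in> W)"
  shows "runs (search flip) s (\<lambda>t s'. \<exists>L'.
    t \<le> 600 * (m + 1) * (n + 1) * card (Pow (side n flip W) - set L) + 150 * (n + 1) \<and>
    env n s' \<and> table n flip L' s' \<and> fresh n L' s' \<and>
    set L' = set L \<union> Pow (side n flip W) \<and> s' ''src'' 0 = s ''src'' 0 + n \<and>
    (\<forall>a\<in>{''family'', ''family_size'', ''row''}. s' a = s a))"
proof -
  let ?X = "side n flip W"
  let ?loop = "While continue (visit_body flip)"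
  have *: "runs (search flip) s (\<lambda>t s'. \<exists>L'.
    t \<le> 600 * (m + 1) * (n + 1) * card (Pow ?X - set L) + 150 * (n + 1) \<and>
    env n s' \<and> table n flip L' s' \<and> fresh n L' s' \<and>
    set L' = set L \<union> Pow ?X \<and> s' ''src'' 0 = s ''src'' 0 + n)"
    unfolding search_def runs_Seq
  proof (rule runs_conseq[OF runs_load[OF assms(1) W row]], assumption, goal_cases)
    case (1 t s1)
    let ?s = "s1(''depth'' := (s1 ''depth'')(0 := 0), ''live'' := (s1 ''live'')(0 := 1),
      ''item'' := (s1 ''item'')(0 := 1))"
    have frame: "?s a = s a"
      if "a \<notin> {''code'', ''item'', ''cur'', ''src'', ''depth'', ''live''}" for a
      using 1 that by simp
    have "env n ?s" by (rule env_frame[OF assms(1)], rule frame) auto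
    moreover have val: "?s ''val'' = s ''val''" by (rule frame) simp
    moreover have "table n flip L ?s"
    proof (rule table_frame[OF assms(2)])
      show "?s a = s a" if "a \<in> {''done'', ''out_size'', ''dst'', ''out_sets'', ''out_answers''}" for a
        using that by (intro frame) auto
    qed (simp only: val)
    moreover have "current n ?X ?s" using 1 unfolding current_def by simp
    ultimately have search: "searching n flip L ?X ?s" unfolding searching_def by simp
    note D = searchingD[OF search]
    have item: "?s ''item'' 0 = 1" by simp
    have fresh: "\<forall>Z\<subseteq>?X. Z \<notin> set L \<longrightarrow> ?s ''val'' (set_encode Z) = of_bool (Z = {})"
      using assms(3) D(6) unfolding fresh_def val by (meson order_trans)
    obtain u L' s2 where w: "walk n flip L ?X ?s u L' s2"
      and u: "u \<le> 600 * (m + 1) * (n + 1) * card (Pow ?X - set L)"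
      using visit[OF search item assms(4) fresh] by blast
    have r: "reach continue (visit_body flip) ?s u s2" and s2: "searching n flip L' ?X s2"
      and L': "set L' = set L \<union> Pow ?X" and depth: "s2 ''depth'' 0 = 0"
      using w unfolding walk_def by simp_all
    note D2 = searchingD[OF s2]
    have val2: "s2 ''val'' (set_encode Y) = s ''val'' (set_encode Y)"
      if "Y \<subseteq> {1..n}" "\<not> Y \<subseteq> ?X" for Y
      using w that val unfolding walk_def by simp
    have src: "s2 ''src'' 0 = s ''src'' 0 + n"
    proof -
      have "s2 ''src'' = ?s ''src''"
        using r by (rule reach_frame) (simp add: visit_body_writes)
      then show ?thesis using 1 by simp
    qed
    have X: "?X \<in> set L'" using L' by simp
    have loop: "runs ?loop ?s (\<lambda>v s3. v \<le> u + 40 \<and> s3 = s2(''live'' := (s2 ''live'')(0 := 0)))"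
      using runs_reach_While[OF r, of "\<lambda>v s3. v \<le> u + 40 \<and> s3 = s2(''live'' := (s2 ''live'')(0 := 0))"]
        visit_exit[OF s2 X depth] by simp
    let ?s3 = "s2(''live'' := (s2 ''live'')(0 := 0))"
    have "env n ?s3" by (rule env_frame[OF D2(1)]) auto
    moreover have "table n flip L' ?s3" by (rule table_frame[OF D2(3)]) auto
    moreover have "fresh n L' ?s3"
      using assms(3) val2 L' unfolding fresh_def by simp
    moreover have "?s3 ''src'' 0 = s ''src'' 0 + n" using src by simp
    ultimately have fin: "env n ?s3 \<and> table n flip L' ?s3 \<and> fresh n L' ?s3 \<and>
        set L' = set L \<union> Pow ?X \<and> ?s3 ''src'' 0 = s ''src'' 0 + n"
      using L' by simp
    have "t \<le> 60 * (n + 1)" using 1 by simp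
    then have "runs ?loop ?s (\<lambda>v s3. \<exists>L'.
        t + (9 + v) \<le> 600 * (m + 1) * (n + 1) * card (Pow ?X - set L) + 150 * (n + 1) \<and>
        env n s3 \<and> table n flip L' s3 \<and> fresh n L' s3 \<and>
        set L' = set L \<union> Pow ?X \<and> s3 ''src'' 0 = s ''src'' 0 + n)"
      using fin u by (intro runs_conseq[OF loop] exI[of _ L']) auto
    then show ?case by (simp add: eval_nat_numeral)
  qed
  have "''family'' \<notin> writes (search flip)" "''family_size'' \<notin> writes (search flip)"
    "''row'' \<notin> writes (search flip)"
    unfolding search_def load_def load_body_def by (simp_all add: visit_body_writes)
  then show ?thesis using runs_frame[OF *] by (elim runs_conseq) auto
qed

text \<open>The assumption pretends that the powers are already in place, and thereby demands of
  \<open>s\<close> just the input part of \<open>env\<close>.\<close>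

lemma runs_init:
  assumes "env n (s(''pow'' := (^) 2))"
  shows "runs init s (\<lambda>t s'. t \<le> 60 * (n + 1) \<and> env n s' \<and>
    s' ''val'' = (s ''val'')(0 := 1) \<and>
    (\<forall>a. a \<notin> {''val'', ''pow'', ''item''} \<longrightarrow> s' a = s a))"
proof -
  define I where "I s' \<longleftrightarrow> 1 \<le> s' ''item'' 0 \<and> s' ''item'' 0 \<le> n + 1 \<and>
    (\<forall>k<s' ''item'' 0. s' ''pow'' k = 2 ^ k) \<and> s' ''val'' = (s ''val'')(0 := 1) \<and>
    (\<forall>a. a \<notin> {''val'', ''pow'', ''item''} \<longrightarrow> s' a = s a)" for s' :: store
  define \<Phi> where "\<Phi> s' = 50 * (n + 1 - s' ''item'' 0)" for s' :: store
  have n: "s ''n'' 0 = n" using assms unfolding env_def by simp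
  have step: "runs powers_body s' (\<lambda>t s''. I s'' \<and>
      1 + bcost (Leq (var ''item'') (var ''n'')) + t + \<Phi> s'' \<le> \<Phi> s')"
    if I: "I s'" and b: "bval (Leq (var ''item'') (var ''n'')) s'" for s'
  proof -
    obtain i where i: "s' ''item'' 0 = i + 1"
      using I unfolding I_def by (metis add.commute le_Suc_ex)
    have "s' ''n'' = s ''n''" using I unfolding I_def by simp
    then have i_n: "i + 1 \<le> n" using b i n by simp
    have pow: "s' ''pow'' k = 2 ^ k" if "k < i + 1" for k
      using I i that unfolding I_def by simp
    have time: "50 * (n - i) = 50 * (n - (i + 1)) + 50" using i_n by simp
    have double: "2 ^ i + 2 ^ i = (2 :: nat) ^ (i + 1)" by simp
    have frame: "s' ''val'' = (s ''val'')(0 := 1)"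
      "\<forall>a. a \<notin> {''val'', ''pow'', ''item''} \<longrightarrow> s' a = s a"
      using I unfolding I_def by blast+
    show ?thesis
      using i_n pow frame unfolding powers_body_def I_def \<Phi>_def
      by (simp add: i time double less_Suc_eq del: One_nat_def)
  qed
  show ?thesis
    unfolding init_def runs_Seq runs_Write
  proof (rule runs_conseq[OF runs_While[where I = I and \<Phi> = \<Phi>]], goal_cases)
    case 1
    show ?case unfolding I_def by simp
  next
    case (2 s')
    then show ?case by (rule step)
  next
    case (3 t s1)
    then have I: "I s1" and t: "t \<le> 50 * n + 6" and fin: "\<not> s1 ''item'' 0 \<le> s1 ''n'' 0"
      unfolding \<Phi>_def by auto
    have frame: "s1 a = s a" if "a \<notin> {''val'', ''pow'', ''item''}" for a
      using I that unfolding I_def by blast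
    have "s1 ''item'' 0 = n + 1" using I fin n frame unfolding I_def by simp
    then have "\<forall>i\<in>{1..n}. s1 ''pow'' i = 2 ^ i" using I unfolding I_def by simp
    then have "env n s1" using assms unfolding env_def by (simp add: frame)
    then show ?case using I t unfolding I_def by simp
  qed
qed

lemma input_store_nth:
  "input_store m n w c B Ws ''m'' 0 = m"
  "input_store m n w c B Ws ''n'' 0 = n"
  "i \<in> {1..n} \<Longrightarrow> input_store m n w c B Ws ''w'' (i - 1) = w i"
  "j < m \<Longrightarrow> input_store m n w c B Ws ''c'' j = c (Suc j)"
  "j < m \<Longrightarrow> input_store m n w c B Ws ''B'' j = of_bool (Suc j \<in> B)"
  "input_store m n w c B Ws ''family_size'' 0 = length Ws"
  "k < length Ws \<Longrightarrow> i < n \<Longrightarrow>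
    input_store m n w c B Ws ''family'' (k * n + i) = of_bool (Suc i \<in> Ws ! k)"
  by (auto simp: input_store_def array_def char_vec_nth concat_char_vec_nth concat_index_less
      simp del: upt_Suc)

lemma input_store_other:
  "a \<notin> {''m'', ''n'', ''w'', ''c'', ''B'', ''family_size'', ''family''} \<Longrightarrow>
    input_store m n w c B Ws a = (\<lambda>_. 0)"
  unfolding input_store_def by simp

text \<open>The potential counts the members of the closure that have not been output and the rows left.\<close>

lemma runs_rows:
  assumes "env n s" "table n flip [] s" "fresh n [] s"
    and Ws: "set Ws \<subseteq> Pow {1..n}"
    and size: "s ''family_size'' 0 = length Ws" and start: "s ''row'' 0 = 0" "s ''src'' 0 = 0"
    and rows: "\<And>k i. k < length Ws \<Longrightarrow> i < n \<Longrightarrow> s ''family'' (k * n + i) = of_bool (Suc i \<in> Ws ! k)"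
    and F: "F = down_closure (side n flip ` set Ws)"
  shows "runs (While (Leq (Add (var ''row'') (Const 1)) (var ''family_size''))
      (search flip ;; incr ''row'')) s
    (\<lambda>t s'. t \<le> 600 * (m + 1) * (n + 1) * card F + 200 * (n + 1) * length Ws + 10 \<and>
      (\<exists>L. set L = F \<and> table n flip L s'))"
proof -
  define I where "I s' \<longleftrightarrow> s' ''row'' 0 \<le> length Ws \<and> s' ''src'' 0 = s' ''row'' 0 * n \<and>
    s' ''family'' = s ''family'' \<and> s' ''family_size'' = s ''family_size'' \<and>
    (\<exists>L. env n s' \<and> table n flip L s' \<and> fresh n L s' \<and>
      set L = (\<Union>k<s' ''row'' 0. Pow (side n flip (Ws ! k))))" for s' :: store
  define K where "K = 600 * (m + 1) * (n + 1)"
  define \<Phi> where "\<Phi> s' = K * (card F - s' ''out_size'' 0) +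
    200 * (n + 1) * (length Ws - s' ''row'' 0)" for s' :: store
  let ?guard = "Leq (Add (var ''row'') (Const 1)) (var ''family_size'')"
  have set_Ws: "set Ws = (!) Ws ` {..<length Ws}" by (auto simp: set_conv_nth)
  have F_eq: "F = (\<Union>k<length Ws. Pow (side n flip (Ws ! k)))"
    unfolding F down_closure_def set_Ws by auto
  have "F \<subseteq> Pow {1..n}" using Ws unfolding F down_closure_def side_def by (auto split: if_splits)
  then have finF: "finite F" by (rule finite_subset) simp
  have step: "runs (search flip ;; incr ''row'') s'
      (\<lambda>t s''. I s'' \<and> 1 + bcost ?guard + t + \<Phi> s'' \<le> \<Phi> s')"
    if I: "I s'" and b: "bval ?guard s'" for s'
  proof -
    obtain L where L: "env n s'" "table n flip L s'" "fresh n L s'"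
      "set L = (\<Union>k<s' ''row'' 0. Pow (side n flip (Ws ! k)))"
      using I unfolding I_def by blast
    define r where "r = s' ''row'' 0"
    have r: "r < length Ws" using b I size unfolding I_def r_def by simp
    have src: "s' ''src'' 0 = r * n" using I unfolding I_def r_def by simp
    have row: "s' ''family'' (s' ''src'' 0 + i) = of_bool (Suc i \<in> Ws ! r)" if "i < n" for i
      using I rows[OF r that] src unfolding I_def by simp
    have Wr: "Ws ! r \<subseteq> {1..n}" using Ws nth_mem[OF r] by blast
    have down: "\<forall>Z\<in>set L. Pow Z \<subseteq> set L" unfolding L(4) by blast
    have sizeL: "s' ''out_size'' 0 = card (set L)"
      using L(2) unfolding table_def by (simp add: distinct_card)
    let ?P = "Pow (side n flip (Ws ! r))"
    show ?thesis
      unfolding runs_Seq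
    proof (rule runs_conseq[OF runs_search[OF L(1-3) down Wr row]], assumption, goal_cases)
      case (1 t s2)
      then obtain L' where t: "t \<le> K * card (?P - set L) + 150 * (n + 1)"
        and s2: "env n s2" "table n flip L' s2" "fresh n L' s2" "set L' = set L \<union> ?P"
          "s2 ''src'' 0 = r * n + n"
        and frame: "s2 ''family'' = s' ''family''" "s2 ''family_size'' = s' ''family_size''"
          "s2 ''row'' = s' ''row''"
        unfolding K_def src by auto
      let ?s = "s2(''row'' := (s2 ''row'')(0 := r + 1))"
      have "set L' = (\<Union>k<r + 1. Pow (side n flip (Ws ! k)))"
        unfolding s2(4) L(4) r_def by (auto simp: less_Suc_eq)
      moreover have "env n ?s" by (rule env_frame[OF s2(1)]) auto
      moreover have "table n flip L' ?s" by (rule table_frame[OF s2(2)]) auto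
      moreover have "fresh n L' ?s" using s2(3) unfolding fresh_def by simp
      ultimately have I': "I ?s"
        unfolding I_def using r s2(5) frame I[unfolded I_def] by auto
      have size2: "?s ''out_size'' 0 = card (set L')"
        using s2(2) unfolding table_def by (simp add: distinct_card)
      have card: "card (set L') = card (set L) + card (?P - set L)"
        using card_Un_disjoint[of "set L" "?P - set L"] finite_subset[OF Wr] s2(4)
        by (metis Diff_disjoint List.finite_set Un_Diff_cancel finite_Un)
      \<comment> \<open>The potential uses truncated subtraction; containment in \<open>F\<close>
        guarantees that it drops by the full number of newly finished sets.\<close>
      have "set L \<subseteq> F"
        unfolding L(4) F_eq r_def[symmetric] using r by (intro UN_mono) auto
      moreover have "?P \<subseteq> F" unfolding F_eq using r by (intro UN_upper) simp
      ultimately have "set L' \<subseteq> F" unfolding s2(4) by simp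
      then have "card (set L') \<le> card F" using finF by (rule card_mono[rotated])
      with card have rest: "card F - card (set L) = card (?P - set L) + (card F - card (set L'))"
        by linarith
      have next_row: "length Ws - r = (length Ws - (r + 1)) + 1" using r by simp
      have "\<Phi> s' = K * card (?P - set L) + K * (card F - card (set L')) +
          200 * (n + 1) * (length Ws - (r + 1)) + 200 * (n + 1)"
        unfolding \<Phi>_def sizeL r_def[symmetric] rest next_row by (simp only: distrib_left mult_1_right add.assoc)
      moreover have "\<Phi> ?s = K * (card F - card (set L')) + 200 * (n + 1) * (length Ws - (r + 1))"
        unfolding \<Phi>_def size2 by simp
      ultimately have "t + 20 + \<Phi> ?s \<le> \<Phi> s'" using t by simp
      then show ?case using I' frame(3) by (simp add: r_def[symmetric] eval_nat_numeral)
    qed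
  qed
  show ?thesis
  proof (rule runs_conseq[OF runs_While[where I = I and \<Phi> = \<Phi>]], goal_cases)
    case 1
    show ?case using assms unfolding I_def by (auto intro!: exI[of _ "[]"])
  next
    case (2 s')
    then show ?case by (rule step)
  next
    case (3 t s')
    then have I: "I s'" and fin: "\<not> s' ''row'' 0 + 1 \<le> s' ''family_size'' 0"
      and t: "t \<le> \<Phi> s + 1 + bcost ?guard" by auto
    have "s' ''row'' 0 = length Ws" using I fin size unfolding I_def by simp
    then obtain L where "set L = F" "table n flip L s'" using I unfolding I_def F_eq by auto
    moreover have "\<Phi> s = K * card F + 200 * (n + 1) * length Ws"
      using start assms(2) unfolding \<Phi>_def table_def by simp
    ultimately show ?case using t unfolding K_def by auto
  qed
qed

section \<open>Total running time and complementation\<close>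

lemma side_side: "X \<subseteq> {1..n} \<Longrightarrow> side n flip (side n flip X) = X"
  unfolding side_def by auto

lemma inj_on_side: "inj_on (side n flip) (Pow {1..n})"
  by (rule inj_on_inverseI[of _ "side n flip"]) (simp add: side_side)

text \<open>Both claims are instances: \<open>F\<close> is always a down-closure, taken of the
  complemented sets if \<open>flip\<close> holds, and its members are complemented again in the
  output.\<close>

lemma program_correct:
  assumes "distinct Ws" "set Ws \<subseteq> Pow {1..n}" and F: "F = down_closure (side n flip ` set Ws)"
  shows "\<exists>t s. exec (program flip) (input_store m n w c B Ws) t s \<and>
    t \<le> 3000 * (m + 1) * max 1 (card F * n) \<and>
    outputs s n (side n flip ` F) (\<lambda>X. can_divide w c (side n flip X) B)"
proof -
  let ?s = "input_store m n w c B Ws"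
  have F_sub: "F \<subseteq> Pow {1..n}"
    using assms(2) unfolding F down_closure_def side_def by (auto split: if_splits)
  then have finF: "finite F" by (rule finite_subset) simp
  have out: "outputs s n (side n flip ` F) (\<lambda>X. can_divide w c (side n flip X) B)"
    if L: "set L = F" "table n flip L s" for L s
    unfolding outputs_def
  proof (intro exI conjI)
    have sub: "set L \<subseteq> Pow {1..n}" using L F_sub by simp
    show "distinct (map (side n flip) L)"
      using L(2) inj_on_subset[OF inj_on_side sub] unfolding table_def by (simp add: distinct_map)
    show "set (map (side n flip) L) = side n flip ` F" using L(1) by simp
    show "holds s ''out_size'' [length (map (side n flip) L)]"
      using L(2) unfolding table_def holds_def by simp
    show "holds s ''out_sets'' (concat (map (char_vec n) (map (side n flip) L)))"
      using L(2) unfolding table_def by blast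
    have answers: "map (\<lambda>X. if can_divide w c (side n flip X) B then 1 else 0 :: nat) (map (side n flip) L) =
        map (\<lambda>Y. if can_divide w c Y B then 1 else 0) L"
      using sub side_side by (auto simp: subset_iff)
    show "holds s ''out_answers''
        (map (\<lambda>X. if can_divide w c (side n flip X) B then 1 else 0) (map (side n flip) L))"
      using L(2) unfolding answers table_def by simp
  qed
  have "runs (program flip) ?s (\<lambda>t s.
    t \<le> 3000 * (m + 1) * max 1 (card F * n) \<and> (\<exists>L. set L = F \<and> table n flip L s))"
  proof (cases "Ws = []")
    case True
    then have "F = {}" unfolding F down_closure_def by simp
    moreover have "table n flip [] ?s"
      unfolding table_def holds_def by (simp add: input_store_other)
    ultimately show ?thesis
      using True unfolding program_def by (simp add: input_store_nth)
  next
    case False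
    \<comment> \<open>The rows are distinct and their sides lie in \<open>F\<close>, so there are at
      most \<open>card F\<close> rows and reading them stays within the bound.\<close>
    have "inj_on (side n flip) (set Ws)" using inj_on_subset[OF inj_on_side assms(2)] .
    then have "card (side n flip ` set Ws) = length Ws"
      using assms(1) by (simp add: card_image distinct_card)
    moreover have "side n flip ` set Ws \<subseteq> F" unfolding F down_closure_def by blast
    ultimately have len: "length Ws \<le> card F" using card_mono[OF finF] by metis
    have pos: "1 \<le> card F" using len False by (cases Ws) auto
    \<comment> \<open>For \<open>n = 0\<close> the product with \<open>n\<close> vanishes, but then
      \<open>F\<close> has at most one member and the 1 in the maximum suffices.\<close>
    have time: "(n + 1) * card F \<le> 2 * max 1 (card F * n)"
    proof (cases "n = 0")
      case True
      then have "card F \<le> card (Pow {1..n})" using F_sub by (intro card_mono) auto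
      then show ?thesis using True by simp
    next
      case False
      then have "card F \<le> card F * n" by simp
      moreover have "(n + 1) * card F = card F * n + card F" by simp
      moreover have "card F * n \<le> max 1 (card F * n)" by (rule max.cobounded2)
      ultimately show ?thesis by linarith
    qed
    have init: "env n (?s(''pow'' := (^) 2))"
      unfolding env_def by (simp add: input_store_nth del: One_nat_def)
    have "runs (program flip) ?s (\<lambda>t s.
      t \<le> 20 + 60 * (n + 1) + 600 * (m + 1) * (n + 1) * card F + 200 * (n + 1) * length Ws \<and>
      (\<exists>L. set L = F \<and> table n flip L s))"
    proof -
      have body: "runs (init ;;
          While (Leq (Add (var ''row'') (Const 1)) (var ''family_size'')) (search flip ;; incr ''row''))
        ?s (\<lambda>t s. t \<le> 10 + 60 * (n + 1) + 600 * (m + 1) * (n + 1) * card F +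
          200 * (n + 1) * length Ws \<and> (\<exists>L. set L = F \<and> table n flip L s))"
        unfolding runs_Seq[of init]
      proof (rule runs_conseq[OF runs_init[OF init]], goal_cases)
        case (1 t s1)
        have frame: "s1 a = ?s a" if "a \<notin> {''val'', ''pow'', ''item''}" for a using 1 that by simp
        have "table n flip [] s1"
          unfolding table_def holds_def by (simp add: frame input_store_other)
        moreover have "fresh n [] s1"
        proof -
          have "set_encode Y = 0 \<longleftrightarrow> Y = {}" if "Y \<subseteq> {1..n}" for Y
            using set_encode_inject[OF that, of "{}"] by simp
          moreover have "s1 ''val'' = (?s ''val'')(0 := 1)" using 1 by blast
          ultimately show ?thesis unfolding fresh_def by (simp add: input_store_other)
        qed
        moreover have "s1 ''family_size'' 0 = length Ws" "s1 ''row'' 0 = 0" "s1 ''src'' 0 = 0"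
          by (simp_all add: frame input_store_nth input_store_other)
        moreover have "s1 ''family'' (k * n + i) = of_bool (Suc i \<in> Ws ! k)"
          if "k < length Ws" "i < n" for k i
          using that by (simp add: frame input_store_nth)
        moreover have "env n s1" using 1 by blast
        ultimately show ?case
          using 1 by (intro runs_conseq[OF runs_rows[OF _ _ _ assms(2) _ _ _ _ F]]) auto
      qed
      have guard: "bval (positive (var ''family_size'')) ?s"
        using False by (simp add: input_store_nth Suc_le_eq)
      show ?thesis
        unfolding program_def runs_Cond if_P[OF guard] by (rule runs_conseq[OF body]) simp
    qed
    then show ?thesis
    proof (rule runs_conseq, goal_cases)
      case (1 t s)
      let ?M = "(n + 1) * card F"
      have "n + 1 \<le> ?M" using mult_le_mono2[OF pos, of "n + 1"] by simp
      moreover have "(n + 1) * length Ws \<le> ?M" using len by (intro mult_le_mono) auto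
      \<comment> \<open>Here 280 is 20 + 60 + 200: the constant term, the initialisation and the
        rows are each bounded by a multiple of \<open>?M\<close>.\<close>
      ultimately have "t \<le> 280 * ?M + 600 * (m + 1) * ?M" using 1 by (simp add: algebra_simps)
      also have "\<dots> \<le> 1000 * (m + 1) * ?M" by (simp add: algebra_simps)
      also have "\<dots> \<le> 1000 * (m + 1) * (2 * max 1 (card F * n))"
        using time by (rule mult_le_mono2)
      also have "\<dots> \<le> 3000 * (m + 1) * max 1 (card F * n)" by (simp add: algebra_simps)
      finally show ?case using 1 by blast
    qed
  qed
  then show ?thesis unfolding runs_def using out by blast
qed

end

text \<open>Complementation within \<open>{1..n}\<close> reverses inclusion and is an involution
  there.\<close>

lemma up_closure_eq:
  assumes "\<W> \<subseteq> Pow {1..n}"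
  shows "up_closure n \<W> = (\<lambda>X. {1..n} - X) ` down_closure ((\<lambda>X. {1..n} - X) ` \<W>)"
proof (intro set_eqI iffI)
  fix X assume "X \<in> up_closure n \<W>"
  then obtain S where "X \<subseteq> {1..n}" "S \<in> \<W>" "S \<subseteq> X" unfolding up_closure_def by blast
  then have "{1..n} - X \<in> down_closure ((\<lambda>X. {1..n} - X) ` \<W>)" "X = {1..n} - ({1..n} - X)"
    unfolding down_closure_def by auto
  then show "X \<in> (\<lambda>X. {1..n} - X) ` down_closure ((\<lambda>X. {1..n} - X) ` \<W>)" by (rule rev_image_eqI)
next
  fix X assume "X \<in> (\<lambda>X. {1..n} - X) ` down_closure ((\<lambda>X. {1..n} - X) ` \<W>)"
  then obtain Y S where "X = {1..n} - Y" "S \<in> \<W>" "Y \<subseteq> {1..n} - S"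
    unfolding down_closure_def by blast
  then show "X \<in> up_closure n \<W>" using assms unfolding up_closure_def by blast
qed

text \<open>One program serves all \<open>m\<close>, and only the constant depends on
  \<open>m\<close>, linearly. The maximum with 1 is there because every run takes time, while the
  product is zero if the closure is empty or \<open>n = 0\<close>.\<close>

theorem theorem2p6:
  "(\<exists>prog. \<forall>m. \<exists>C. \<forall>n w c B Ws.
      B \<subseteq> {1..m} \<longrightarrow> distinct Ws \<longrightarrow> set Ws \<subseteq> Pow {1..n} \<longrightarrow>
      (\<exists>t s. exec prog (input_store m n w c B Ws) t s \<and>
         t \<le> C * max 1 (card (down_closure (set Ws)) * n) \<and>
         outputs s n (down_closure (set Ws)) (\<lambda>X. can_divide w c X B))) \<and>
   (\<exists>prog. \<forall>m. \<exists>C. \<forall>n w c B Ws.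
      B \<subseteq> {1..m} \<longrightarrow> distinct Ws \<longrightarrow> set Ws \<subseteq> Pow {1..n} \<longrightarrow>
      (\<exists>t s. exec prog (input_store m n w c B Ws) t s \<and>
         t \<le> C * max 1 (card (up_closure n (set Ws)) * n) \<and>
         outputs s n (up_closure n (set Ws)) (\<lambda>X. can_divide w c ({1..n} - X) B)))"
proof (intro conjI)
  show "\<exists>prog. \<forall>m. \<exists>C. \<forall>n w c B Ws.
      B \<subseteq> {1..m} \<longrightarrow> distinct Ws \<longrightarrow> set Ws \<subseteq> Pow {1..n} \<longrightarrow>
      (\<exists>t s. exec prog (input_store m n w c B Ws) t s \<and>
         t \<le> C * max 1 (card (down_closure (set Ws)) * n) \<and>
         outputs s n (down_closure (set Ws)) (\<lambda>X. can_divide w c X B))"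
  \<comment> \<open>The constant \<open>C\<close> is left open here and becomes
    \<open>3000 * (m + 1)\<close> through the goal shown below; it may mention only
    \<open>m\<close>.\<close>
  proof (rule exI[of _ "program False"], rule allI, rule exI, intro allI impI)
    fix m n :: nat and w c B and Ws :: "nat set list"
    assume *: "B \<subseteq> {1..m}" "distinct Ws" "set Ws \<subseteq> Pow {1..n}"
    interpret bin_packing m w c B using *(1) by unfold_locales
    have id: "side n False = (\<lambda>X. X)" unfolding side_def by simp
    show "\<exists>t s. exec (program False) (input_store m n w c B Ws) t s \<and>
        t \<le> 3000 * (m + 1) * max 1 (card (down_closure (set Ws)) * n) \<and>
        outputs s n (down_closure (set Ws)) (\<lambda>X. can_divide w c X B)"
      using program_correct[OF *(2,3), of _ False] unfolding id by simp
  qed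
  show "\<exists>prog. \<forall>m. \<exists>C. \<forall>n w c B Ws.
      B \<subseteq> {1..m} \<longrightarrow> distinct Ws \<longrightarrow> set Ws \<subseteq> Pow {1..n} \<longrightarrow>
      (\<exists>t s. exec prog (input_store m n w c B Ws) t s \<and>
         t \<le> C * max 1 (card (up_closure n (set Ws)) * n) \<and>
         outputs s n (up_closure n (set Ws)) (\<lambda>X. can_divide w c ({1..n} - X) B))"
  proof (rule exI[of _ "program True"], rule allI, rule exI, intro allI impI)
    fix m n :: nat and w c B and Ws :: "nat set list"
    assume *: "B \<subseteq> {1..m}" "distinct Ws" "set Ws \<subseteq> Pow {1..n}"
    interpret bin_packing m w c B using *(1) by unfold_locales
    let ?F = "down_closure (side n True ` set Ws)"
    have compl: "side n True = (\<lambda>X. {1..n} - X)" unfolding side_def by simp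
    have up: "up_closure n (set Ws) = side n True ` ?F"
      unfolding compl using up_closure_eq[OF *(3)] .
    have "?F \<subseteq> Pow {1..n}" unfolding down_closure_def compl by auto
    \<comment> \<open>Complementation is injective on subsets of \<open>{1..n}\<close>, so the bound
      in terms of the down-closure is the required bound in terms of the up-closure.\<close>
    then have "card (up_closure n (set Ws)) = card ?F"
      unfolding up using inj_on_subset[OF inj_on_side] by (intro card_image)
    then show "\<exists>t s. exec (program True) (input_store m n w c B Ws) t s \<and>
        t \<le> 3000 * (m + 1) * max 1 (card (up_closure n (set Ws)) * n) \<and>
        outputs s n (up_closure n (set Ws)) (\<lambda>X. can_divide w c ({1..n} - X) B)"
      using program_correct[OF *(2,3), of ?F True] unfolding up by (simp add: compl)
  qed
qed

end
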